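(* Let $p_1,p_2$ be distinct odd primes. Then there exists an odd prime $p_0$ such that $p_2$ is the smallest odd prime dividing $p_0+p_1$. *)

theory Defs
  imports "HOL-Computational_Algebra.Primes"
begin

end

theory Submission
  imports Defs
    "HOL-Number_Theory.Prime_Powers" "HOL-Number_Theory.Residue_Primitive_Roots"
    "HOL-Computational_Algebra.Squarefree"
begin

text \<open>
  Let \<open>m\<close> be the product of the odd primes up to \<open>p2\<close>. By the Chinese remainder theorem there is
  a unit \<open>a\<close> modulo \<open>m\<close> with \<open>a = - p1\<close> modulo \<open>p2\<close> and \<open>a \<noteq> - p1\<close> modulo every
  smaller odd prime, so any odd prime \<open>p0\<close> congruent to \<open>a\<close> will do. Its existence is
  Dirichlet's theorem for the squarefree modulus \<open>m\<close>.

  Dirichlet's theorem follows once the sums of \<open>\<chi> n * \<Lambda> n / n\<close> over \<open>n \<le> N\<close> are bounded for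
  every nonprincipal character \<open>\<chi>\<close>. Moebius inversion gives this bound if
  \<open>L(1, \<chi>) \<noteq> 0\<close>, and shows that the sum is \<open>- ln N + O(1)\<close> if \<open>L(1, \<chi>) = 0\<close>. Summing over
  all characters gives a multiple of a sum of nonnegative terms, while the principal character
  contributes at most \<open>3 / 2 * ln N + O(1)\<close>; so at most one character has \<open>L(1, \<chi>) = 0\<close>, and
  it must be real because it equals its conjugate. Real characters are excluded by Monsky's
  Lambert series argument.
\<close>

section \<open>Divisor sums and the von Mangoldt function\<close>

text \<open>Trades floors for quotients: tail bounds start at \<open>Suc (N div d)\<close> and are
  compared with their value at \<open>N / d\<close>.\<close>

lemma real_divide_less_Suc_div:
  assumes "d > 0"
  shows "real n / real d < real (Suc (n div d))"
proof -
  have "n < d * Suc (n div d)" using dividend_less_times_div[OF assms, of n] by simp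
  then have "real n < real d * real (Suc (n div d))" by (metis of_nat_less_iff of_nat_mult)
  then show ?thesis using assms by (simp add: divide_less_eq mult.commute del: of_nat_Suc)
qed

text \<open>Both sides run over the pairs of positive integers with product at most
  \<open>N\<close>, grouped once by the product and once by the first factor.\<close>

lemma sum_divisor_pairs_upto:
  fixes f :: "nat \<Rightarrow> nat \<Rightarrow> 'a::comm_monoid_add"
  shows "(\<Sum>n=1..N. \<Sum>d | d dvd n. f d (n div d)) = (\<Sum>d=1..N. \<Sum>k=1..N div d. f d k)"
proof -
  have "(\<Sum>n=1..N. \<Sum>d | d dvd n. f d (n div d)) =
      (\<Sum>(n, d)\<in>(SIGMA n:{1..N}. {d. d dvd n}). f d (n div d))"
    by (subst sum.Sigma) (auto intro: finite_divisors_nat)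
  also have "\<dots> = (\<Sum>(d, k)\<in>(SIGMA d:{1..N}. {1..N div d}). f d k)"
  proof (rule sum.reindex_bij_witness[where
        i = "\<lambda>(d, k). (d * k, d)" and j = "\<lambda>(n, d). (d, n div d)"], goal_cases)
    case (2 a)
    then obtain n d where a: "a = (n, d)" "n \<in> {1..N}" "d dvd n" by auto
    then have "d \<ge> 1" "d \<le> N" "n div d \<le> N div d" "n div d \<ge> 1"
      by (auto simp: Suc_le_eq dvd_imp_le div_le_mono div_greater_zero_iff intro: Nat.gr0I
          dest: dvd_imp_le)
    with a show ?case by auto
  next
    case (4 b)
    then obtain d k where b: "b = (d, k)" "1 \<le> d" "d \<le> N" "1 \<le> k" "k \<le> N div d" by auto
    then have "d * k \<le> N"
      by (metis le_trans mult_le_mono2 times_div_less_eq_dividend)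
    with b show ?case by auto
  qed auto
  also have "\<dots> = (\<Sum>d=1..N. \<Sum>k=1..N div d. f d k)"
    by (subst sum.Sigma) auto
  finally show ?thesis .
qed

text \<open>Each divisor of \<open>p ^ k * m\<close> is uniquely \<open>p ^ i * d\<close> with
  \<open>i \<le> k\<close> and \<open>d\<close> dividing \<open>m\<close>. Multiplicativity across
  \<open>p\<close> is what the Moebius function and real characters have in common.\<close>

lemma sum_divisors_prime_power_mult:
  fixes h :: "nat \<Rightarrow> 'a::comm_semiring_1"
  assumes "prime p" "\<not> p dvd m" "m > 0"
    and mult: "\<And>i d. \<not> p dvd d \<Longrightarrow> h (p ^ i * d) = h (p ^ i) * h d"
  shows "(\<Sum>d | d dvd p ^ k * m. h d) = (\<Sum>i\<le>k. h (p ^ i)) * (\<Sum>d | d dvd m. h d)"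
proof -
  have p0: "p > 0" using assms prime_gt_0_nat by blast
  have ndvd: "\<not> p dvd d" if "d dvd m" for d
    using that assms(2) dvd_trans by blast
  have "(\<Sum>d | d dvd p ^ k * m. h d) = (\<Sum>(i, d)\<in>{..k} \<times> {d. d dvd m}. h (p ^ i * d))"
  proof (rule sum.reindex_bij_witness[where
        j = "\<lambda>n. (multiplicity p n, n div p ^ multiplicity p n)" and i = "\<lambda>(i, d). p ^ i * d"],
      goal_cases)
    case (2 a)
    then have a: "a dvd p ^ k * m" "a \<noteq> 0" using assms(3) p0 by (auto intro: Nat.gr0I)
    let ?i = "multiplicity p a"
    have dec: "a = p ^ ?i * (a div p ^ ?i)" by (simp add: multiplicity_dvd)
    have n: "\<not> p dvd a div p ^ ?i"
      using a assms(1) by (metis multiplicity_decompose not_prime_unit)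
    have "?i \<le> multiplicity p (p ^ k * m)"
      using a p0 assms(3) by (intro dvd_imp_multiplicity_le) auto
    also have "\<dots> = k"
      using assms p0 by (simp add: prime_elem_multiplicity_mult_distrib not_dvd_imp_multiplicity_0)
    finally have "?i \<le> k" .
    moreover have "coprime (a div p ^ ?i) (p ^ k)"
      using n assms(1) by (simp add: prime_imp_coprime coprime_commute coprime_power_left_iff)
    then have "a div p ^ ?i dvd m"
      using a(1) dec by (metis coprime_dvd_mult_right_iff dvd_mult_right)
    ultimately show ?case by auto
  next
    case (3 b)
    then obtain i d where b: "b = (i, d)" "i \<le> k" "d dvd m" by auto
    then have d: "\<not> p dvd d" "d \<noteq> 0" using ndvd assms(3) by (auto dest: gr0I)
    then have "multiplicity p (p ^ i * d) = i"
      using assms(1) p0 by (simp add: prime_elem_multiplicity_mult_distrib not_dvd_imp_multiplicity_0)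
    then show ?case using b p0 by auto
  next
    case (4 b)
    then show ?case by (auto intro: mult_dvd_mono le_imp_power_dvd)
  qed (auto simp: multiplicity_dvd)
  also have "\<dots> = (\<Sum>(i, d)\<in>{..k} \<times> {d. d dvd m}. h (p ^ i) * h d)"
    by (intro sum.cong) (auto simp: mult ndvd)
  also have "\<dots> = (\<Sum>i\<le>k. h (p ^ i)) * (\<Sum>d | d dvd m. h d)"
    by (simp add: sum_product sum.cartesian_product)
  finally show ?thesis .
qed

section \<open>The Moebius function and inversion\<close>

text \<open>The values lie in an arbitrary commutative ring, so that one function serves in both
  real and complex sums.\<close>

definition moebius_mu :: "nat \<Rightarrow> 'a::comm_ring_1" where
  "moebius_mu n = (if squarefree n then (-1) ^ card (prime_factors n) else 0)"

lemma moebius_mu_1 [simp]: "moebius_mu (Suc 0) = 1"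
  by (simp add: moebius_mu_def)

text \<open>For \<open>i = 1\<close> one new prime flips the sign; for \<open>i \<ge> 2\<close>
  neither \<open>p ^ i\<close> nor \<open>p ^ i * d\<close> is squarefree and both sides
  vanish.\<close>

lemma moebius_mu_prime_mult:
  assumes "prime p" "\<not> p dvd d"
  shows "moebius_mu (p ^ i * d) = (moebius_mu (p ^ i) * moebius_mu d :: 'a::comm_ring_1)"
proof (cases "i = 0 \<or> d = 0")
  case True
  with assms show ?thesis by (auto simp: moebius_mu_def)
next
  case False
  have p0: "p > 0" "p \<noteq> 1" using assms prime_gt_0_nat by auto
  have cop: "coprime p d" using assms by (simp add: prime_imp_coprime)
  show ?thesis
  proof (cases "i = 1")
    case True
    have "squarefree (p * d) \<longleftrightarrow> squarefree d"
      using cop assms squarefree_prime[of p] by (auto intro: squarefree_mult_coprime dest: squarefree_multD)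
    moreover have "prime_factors (p * d) = insert p (prime_factors d)"
      using False p0 assms by (simp add: prime_factorization_mult prime_factorization_prime)
    moreover have "p \<notin> prime_factors d" using assms by auto
    ultimately show ?thesis
      using True assms by (auto simp: moebius_mu_def squarefree_prime prime_factorization_prime)
  next
    case i: False
    have "\<not> squarefree (p ^ i)"
      using False i p0 by (auto simp: squarefree_power_iff)
    moreover from this have "\<not> squarefree (p ^ i * d)"
      using squarefree_multD by blast
    ultimately show ?thesis by (simp add: moebius_mu_def)
  qed
qed

text \<open>For \<open>n > 1\<close>, splitting off the full power of a prime \<open>p\<close>
  leaves a factor \<open>1 + moebius_mu p = 0\<close>.\<close>

lemma sum_moebius_mu_divisors:
  assumes "n > 0"
  shows "(\<Sum>d | d dvd n. moebius_mu d) = (if n = 1 then 1 else 0 :: 'a::comm_ring_1)"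
proof (cases "n = 1")
  case False
  then obtain p where p: "prime p" "p dvd n" using prime_factor_nat by blast
  have n0: "n \<noteq> 0" "\<not> is_unit p" using assms p by auto
  obtain m where m: "n = p ^ multiplicity p n * m" "\<not> p dvd m"
    using multiplicity_decompose'[of n p] n0 by (metis)
  define k where "k = multiplicity p n"
  have k: "k > 0" unfolding k_def using p n0
    by (simp add: prime_multiplicity_gt_zero_iff)
  have "(\<Sum>i\<le>k. moebius_mu (p ^ i)) = (\<Sum>i\<in>{0, 1}. moebius_mu (p ^ i) :: 'a)"
    using k p by (intro sum.mono_neutral_right) 
      (auto simp: moebius_mu_def squarefree_power_iff)
  also have "\<dots> = 0"
    using p by (simp add: moebius_mu_def squarefree_prime prime_factorization_prime)
  finally have "(\<Sum>i\<le>k. moebius_mu (p ^ i)) = (0 :: 'a)" .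
  then show ?thesis
    using False p m(2) n0 m(1) sum_divisors_prime_power_mult[of p m "moebius_mu :: nat \<Rightarrow> 'a" k]
    by (simp add: k_def[symmetric] moebius_mu_prime_mult)
qed auto

lemma of_real_moebius_mu [simp]:
  "of_real (moebius_mu n) = (moebius_mu n :: 'a::{real_algebra_1,comm_ring_1})"
  by (simp add: moebius_mu_def)

lemma norm_moebius_mu_le: "norm (moebius_mu n :: 'a::{real_normed_field}) \<le> 1"
  by (simp add: moebius_mu_def norm_power)

text \<open>Moebius inversion of \<open>mangoldt_sum\<close>: expand the logarithm over the divisors
  \<open>e\<close> of \<open>n div d\<close> and exchange the sums; the inner Moebius sum leaves
  only \<open>e = n\<close>.\<close>

lemma sum_moebius_mu_ln:
  assumes "n > 0"
  shows "(\<Sum>d | d dvd n. moebius_mu d * ln (real (n div d))) = mangoldt n"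
proof -
  have fin: "finite {d. d dvd n}" using assms by simp
  have "(\<Sum>d | d dvd n. moebius_mu d * ln (real (n div d))) =
      (\<Sum>d | d dvd n. \<Sum>e | e dvd n div d. moebius_mu d * mangoldt e :: real)"
  proof (rule sum.cong)
    fix d assume "d \<in> {d. d dvd n}"
    then have "n div d \<noteq> 0" using assms by (auto simp: dvd_div_eq_0_iff)
    then have "(\<Sum>e | e dvd n div d. mangoldt e) = ln (real (n div d))"
      using mangoldt_sum[of "n div d", where ?'a = real] by simp
    then show "moebius_mu d * ln (real (n div d)) = (\<Sum>e | e dvd n div d. moebius_mu d * mangoldt e)"
      by (simp only: sum_distrib_left[symmetric])
  qed auto
  also have "\<dots> = (\<Sum>d | d dvd n. \<Sum>e\<in>{e. e dvd n \<and> d * e dvd n}. moebius_mu d * mangoldt e)"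
    using assms by (intro sum.cong) (auto simp: dvd_div_iff_mult mult.commute dest: dvd_mult_right dvd_mult_left)
  also have "\<dots> = (\<Sum>e | e dvd n. \<Sum>d\<in>{d. d dvd n \<and> d * e dvd n}. moebius_mu d * mangoldt e)"
    using sum.swap_restrict[OF fin fin, of "\<lambda>d e. moebius_mu d * mangoldt e" "\<lambda>d e. d * e dvd n"]
    by simp
  also have "\<dots> = (\<Sum>e | e dvd n. (\<Sum>d | d dvd n div e. moebius_mu d) * mangoldt e)"
    using assms by (intro sum.cong)
      (auto simp: dvd_div_iff_mult sum_distrib_right dest: dvd_mult_left intro!: sum.cong)
  also have "\<dots> = (\<Sum>e | e dvd n. if e = n then mangoldt e else 0)"
  proof (rule sum.cong)
    fix e assume "e \<in> {e. e dvd n}"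
    then have "e dvd n" "n div e > 0" using assms by (auto simp: dvd_div_eq_0_iff intro: Nat.gr0I)
    then show "(\<Sum>d | d dvd n div e. moebius_mu d) * mangoldt e = (if e = n then mangoldt e else 0 :: real)"
      using sum_moebius_mu_divisors[of "n div e", where ?'a = real] assms
      by (auto elim!: dvdE split: if_splits)
  qed auto
  also have "\<dots> = mangoldt n"
    using assms by (simp add: sum.delta'[OF fin] )
  finally show ?thesis .
qed

section \<open>Mertens-type bounds from factorials\<close>

text \<open>Legendre's formula in logarithmic form: \<open>N div d\<close> counts the multiples of
  \<open>d\<close> up to \<open>N\<close>.\<close>

lemma ln_fact_eq_sum_mangoldt:
  "ln (fact N) = (\<Sum>d=1..N. mangoldt d * real (N div d))"
proof -
  have "ln (fact N :: real) = (\<Sum>n=1..N. ln (real n))"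
    by (simp add: fact_prod, subst ln_prod) auto
  also have "\<dots> = (\<Sum>n=1..N. \<Sum>d | d dvd n. mangoldt d)"
    by (intro sum.cong) (auto simp: mangoldt_sum)
  also have "\<dots> = (\<Sum>d=1..N. mangoldt d * real (N div d))"
    using sum_divisor_pairs_upto[where f = "\<lambda>d _. mangoldt d :: real"] by (simp add: mult.commute)
  finally show ?thesis .
qed

text \<open>\<open>N ^ N / fact N\<close> is a single term of the series for
  \<open>exp N\<close>.\<close>

lemma ln_fact_ge: "ln (fact N) \<ge> real N * ln (real N) - real N"
proof (cases "N = 0")
  case False
  have "summable (\<lambda>n. real N ^ n /\<^sub>R fact n)" by (rule summable_exp_generic)
  then have "real N ^ N / fact N \<le> exp (real N)"
    unfolding exp_def using sum_le_suminf[of "\<lambda>n. real N ^ n /\<^sub>R fact n" "{N}"]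
    by (simp add: divide_inverse mult.commute)
  then have "real N ^ N \<le> exp (real N) * fact N"
    by (simp add: field_simps)
  then have "ln (real N ^ N) \<le> ln (exp (real N) * fact N)"
    using False by (subst ln_le_cancel_iff) auto
  then show ?thesis
    using False by (simp add: ln_mult ln_realpow)
qed auto

lemma ln_fact_le: "ln (fact N) \<le> real N * ln (real N)"
proof (cases "N = 0")
  case False
  have "ln (fact N :: real) \<le> ln (real N ^ N)"
    using False fact_le_power[of N, where ?'a = real] by (subst ln_le_cancel_iff) auto
  then show ?thesis using False by (simp add: ln_realpow)
qed auto

text \<open>On average over \<open>d\<close> the value \<open>ln (N / d)\<close> is at most 1; this
  keeps the logarithmic errors in the Moebius convolutions bounded.\<close>

lemma sum_ln_ratio_le: "(\<Sum>d=1..N. ln (real N / real d)) \<le> real N"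
proof (cases "N = 0")
  case False
  have "(\<Sum>d=1..N. ln (real N / real d)) = (\<Sum>d=1..N. ln (real N) - ln (real d))"
    using False by (intro sum.cong) (auto simp: ln_div)
  also have "\<dots> = real N * ln (real N) - ln (fact N)"
    by (simp add: sum_subtractf fact_prod, subst ln_prod) auto
  finally show ?thesis using ln_fact_ge[of N] by simp
qed auto

text \<open>Replacing \<open>N div d\<close> by \<open>N / d\<close> in Legendre's formula only
  increases the sum. The loss of 1 is the linear term of \<open>ln_fact_ge\<close> divided by
  \<open>N\<close>.\<close>

lemma sum_mangoldt_div_ge:
  assumes "N > 0"
  shows "(\<Sum>n=1..N. mangoldt n / real n) \<ge> ln (real N) - 1"
proof -
  have "real N * ln (real N) - real N \<le> (\<Sum>d=1..N. mangoldt d * real (N div d))"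
    using ln_fact_ge[of N] ln_fact_eq_sum_mangoldt[of N] by simp
  also have "\<dots> \<le> (\<Sum>d=1..N. mangoldt d * (real N / real d))"
    by (intro sum_mono mult_left_mono of_nat_div_le_of_nat mangoldt_nonneg)
  also have "\<dots> = real N * (\<Sum>n=1..N. mangoldt n / real n)"
    by (simp add: sum_distrib_left mult_ac)
  finally have "real N * (ln (real N) - 1) \<le> real N * (\<Sum>n=1..N. mangoldt n / real n)"
    by (simp add: algebra_simps)
  then show ?thesis using assms by (simp add: mult_le_cancel_left)
qed

text \<open>
  Any constant below 2 would do. It comes from comparing with \<open>(2 * N)!\<close>: for \<open>d \<le> N\<close> the
  quotient \<open>2 * N div d\<close> is at least 2, so it loses at most a third of \<open>2 * N / d\<close> by rounding.
\<close>

lemma sum_mangoldt_div_le: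
  assumes "N > 0"
  shows "(\<Sum>n=1..N. mangoldt n / real n) \<le> 3 / 2 * ln (2 * real N)"
proof -
  have "(2 * real N) * (\<Sum>n=1..N. mangoldt n / real n) = (\<Sum>d=1..N. mangoldt d * (real (2 * N) / real d))"
    by (simp add: sum_distrib_left mult_ac)
  also have "\<dots> \<le> (\<Sum>d=1..N. mangoldt d * (3 / 2 * real (2 * N div d)))"
  proof (intro sum_mono mult_left_mono mangoldt_nonneg)
    fix d assume d: "d \<in> {1..N}"
    then have "2 * N div d \<ge> 2" by (simp add: less_eq_div_iff_mult_less_eq)
    moreover have "real (2 * N) / real d \<le> real (2 * N div d) + 1"
      using real_divide_less_Suc_div[of d "2 * N"] d by simp
    ultimately show "real (2 * N) / real d \<le> 3 / 2 * real (2 * N div d)" by linarith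
  qed
  also have "\<dots> = 3 / 2 * (\<Sum>d=1..N. mangoldt d * real (2 * N div d))"
    by (simp add: sum_distrib_left mult_ac)
  also have "(\<Sum>d=1..N. mangoldt d * real (2 * N div d)) \<le> (\<Sum>d=1..2*N. mangoldt d * real (2 * N div d))"
    by (intro sum_mono2) (auto intro: mult_nonneg_nonneg mangoldt_nonneg)
  also have "\<dots> \<le> real (2 * N) * ln (real (2 * N))"
    using ln_fact_le[of "2 * N"] ln_fact_eq_sum_mangoldt[of "2 * N"] by simp
  finally have "(2 * real N) * (\<Sum>n=1..N. mangoldt n / real n) \<le> (2 * real N) * (3 / 2 * ln (2 * real N))"
    by simp
  then show ?thesis using assms by (simp add: mult_le_cancel_left)
qed

section \<open>Characters with bounded partial sums\<close>

text \<open>Abel summation: the decrements of \<open>g\<close> telescope to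
  \<open>g M - g N\<close>, and the boundary term adds at most \<open>B * g N\<close>.\<close>

lemma norm_sum_antimono_weights_le:
  fixes f :: "nat \<Rightarrow> 'a::real_normed_vector" and g :: "nat \<Rightarrow> real"
  assumes bounded: "\<And>k. norm (\<Sum>n=M..<k. f n) \<le> B"
    and antimono: "\<And>n. M \<le> n \<Longrightarrow> g (Suc n) \<le> g n"
    and nonneg: "\<And>n. M \<le> n \<Longrightarrow> 0 \<le> g n"
    and "M \<le> N"
  shows "norm (\<Sum>n=M..<N. g n *\<^sub>R f n) \<le> B * g M"
proof -
  let ?S = "\<lambda>k. \<Sum>n=M..<k. f n"
  \<comment> \<open>The boundary term is kept apart so that each induction step contributes exactly
    one decrement of \<open>g\<close>.\<close>
  have "norm ((\<Sum>n=M..<N. g n *\<^sub>R f n) - g N *\<^sub>R ?S N) \<le> B * (g M - g N)"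
    using \<open>M \<le> N\<close>
  proof (induction N rule: dec_induct)
    case (step N)
    have "(\<Sum>n=M..<Suc N. g n *\<^sub>R f n) - g (Suc N) *\<^sub>R ?S (Suc N) =
        ((\<Sum>n=M..<N. g n *\<^sub>R f n) - g N *\<^sub>R ?S N) + (g N - g (Suc N)) *\<^sub>R ?S (Suc N)"
      using step by (simp add: algebra_simps)
    also have "norm \<dots> \<le> B * (g M - g N) + (g N - g (Suc N)) * B"
      using step antimono[of N] bounded[of "Suc N"]
      by (intro order_trans[OF norm_triangle_ineq] add_mono) (auto intro: mult_left_mono)
    finally show ?case by (simp add: algebra_simps)
  qed auto
  moreover have "norm (g N *\<^sub>R ?S N) \<le> g N * B"
    using nonneg[OF \<open>M \<le> N\<close>] bounded[of N] by (auto intro: mult_left_mono)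
  ultimately show ?thesis
    using norm_triangle_ineq[of "(\<Sum>n=M..<N. g n *\<^sub>R f n) - g N *\<^sub>R ?S N" "g N *\<^sub>R ?S N"]
    by (simp add: algebra_simps)
qed

text \<open>Follows from \<open>ln (y / x) \<le> y / x - 1\<close> and
  \<open>1 \<le> 1 + ln x\<close>; the second estimate is where the added 1 enters.\<close>

lemma antimono_one_plus_ln_div:
  fixes x y :: real
  assumes "1 \<le> x" "x \<le> y"
  shows "(1 + ln y) / y \<le> (1 + ln x) / x"
proof -
  have "ln (y / x) \<le> y / x - 1" using assms by (intro ln_le_minus_one) auto
  then have "x * (ln y - ln x) \<le> y - x"
    using assms by (simp add: ln_div field_simps)
  also have "\<dots> \<le> (y - x) * (1 + ln x)"
    using assms by (simp add: mult_le_cancel_left1)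
  finally have "x * (1 + ln y) \<le> y * (1 + ln x)" by (simp add: algebra_simps)
  then show ?thesis using assms by (simp add: divide_simps mult.commute)
qed

text \<open>Collects what the analysis uses about a nonprincipal character. The bound covers all
  blocks \<open>M..<N\<close>, since Abel summation is applied to tails.\<close>

locale cancelling_character =
  fixes \<chi> :: "nat \<Rightarrow> complex" and B :: real
  assumes one [simp]: "\<chi> (Suc 0) = 1"
    and mult: "\<chi> (a * b) = \<chi> a * \<chi> b"
    and norm_le_1: "norm (\<chi> n) \<le> 1"
    and norm_sum_le: "norm (\<Sum>n=M..<N. \<chi> n) \<le> B"
begin

text \<open>The value of the L-function at 1; \<open>lim\<close> acquires its meaning through
  \<open>L1_limit\<close>. It depends on \<open>\<chi>\<close> alone, so vanishing can be stated
  without mentioning \<open>B\<close>.\<close>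

definition L1 :: complex where
  "L1 = lim (\<lambda>N. \<Sum>n=1..N. \<chi> n / of_nat n)"

text \<open>Partial sums of the formal series for \<open>1 / L1\<close>.\<close>

definition mu_sum :: "nat \<Rightarrow> complex" where
  "mu_sum N = (\<Sum>d=1..N. moebius_mu d * \<chi> d / of_nat d)"

lemma B_nonneg: "B \<ge> 0"
  using norm_sum_le[of 0 0] by simp

text \<open>Abel summation bounds every block starting at \<open>Suc M\<close> by
  \<open>B * g (Suc M)\<close>. This makes the partial sums Cauchy, and the bound passes to the
  limit.\<close>

lemma weighted_sum_tail:
  fixes g :: "nat \<Rightarrow> real"
  assumes antimono: "\<And>n. 1 \<le> n \<Longrightarrow> g (Suc n) \<le> g n"
    and nonneg: "\<And>n. 1 \<le> n \<Longrightarrow> 0 \<le> g n"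
    and lim0: "g \<longlonglongrightarrow> 0"
  shows "\<exists>L. (\<lambda>N. \<Sum>n=1..N. \<chi> n * of_real (g n)) \<longlonglongrightarrow> L \<and>
    (\<forall>N. norm (L - (\<Sum>n=1..N. \<chi> n * of_real (g n))) \<le> B * g (Suc N))"
proof -
  let ?s = "\<lambda>N. \<Sum>n=1..N. \<chi> n * of_real (g n)"
  have diff: "norm (?s N - ?s M) \<le> B * g (Suc M)" if "M \<le> N" for M N
  proof -
    have "{1..<Suc N} = {1..<Suc M} \<union> {Suc M..<Suc N}" using that by auto
    then have "?s N = ?s M + (\<Sum>n=Suc M..<Suc N. \<chi> n * of_real (g n))"
      unfolding atLeastLessThanSuc_atLeastAtMost[symmetric]
      by (simp only:) (subst sum.union_disjoint, auto)
    also have "(\<Sum>n=Suc M..<Suc N. \<chi> n * of_real (g n)) = (\<Sum>n=Suc M..<Suc N. g n *\<^sub>R \<chi> n)"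
      by (simp add: scaleR_conv_of_real mult.commute)
    finally have "norm (?s N - ?s M) = norm (\<Sum>n=Suc M..<Suc N. g n *\<^sub>R \<chi> n)" by simp
    also have "\<dots> \<le> B * g (Suc M)"
      using that by (intro norm_sum_antimono_weights_le norm_sum_le antimono nonneg) auto
    finally show ?thesis .
  qed
  have Bg: "(\<lambda>M. B * g (Suc M)) \<longlonglongrightarrow> 0"
    using tendsto_mult[OF tendsto_const[of B] LIMSEQ_Suc[OF lim0]] by simp
  have "Cauchy ?s"
  proof (rule metric_CauchyI)
    fix e :: real assume e: "e > 0"
    then obtain M where M: "\<And>k. k \<ge> M \<Longrightarrow> B * g (Suc k) < e"
      using order_tendstoD(2)[OF Bg] by (auto simp: eventually_at_top_linorder)
    have "dist (?s i) (?s j) < e" if "i \<ge> M" "j \<ge> M" for i j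
    proof (cases "i \<le> j")
      case True
      then show ?thesis using diff[of i j] M[of i] that by (simp add: dist_norm norm_minus_commute)
    next
      case False
      then show ?thesis using diff[of j i] M[of j] that by (simp add: dist_norm)
    qed
    then show "\<exists>M. \<forall>i\<ge>M. \<forall>j\<ge>M. dist (?s i) (?s j) < e" by blast
  qed
  then obtain L where L: "?s \<longlonglongrightarrow> L"
    using Cauchy_convergent_iff convergent_def by blast
  moreover have "norm (L - ?s N) \<le> B * g (Suc N)" for N
  proof (rule tendsto_upperbound)
    show "(\<lambda>k. norm (?s k - ?s N)) \<longlonglongrightarrow> norm (L - ?s N)"
      by (intro tendsto_intros L)
    show "\<forall>\<^sub>F k in sequentially. norm (?s k - ?s N) \<le> B * g (Suc N)"
      using eventually_ge_at_top[of N] by eventually_elim (rule diff)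
  qed simp
  ultimately show ?thesis by blast
qed

lemma
  shows L1_limit: "(\<lambda>N. \<Sum>n=1..N. \<chi> n / of_nat n) \<longlonglongrightarrow> L1"
    and norm_L1_tail: "norm (L1 - (\<Sum>n=1..N. \<chi> n / of_nat n)) \<le> B / real (Suc N)"
proof -
  have eq: "\<chi> n * complex_of_real (1 / real n) = \<chi> n / of_nat n" for n
    by simp
  have "\<exists>L. (\<lambda>N. \<Sum>n=1..N. \<chi> n * of_real (1 / real n)) \<longlonglongrightarrow> L \<and>
      (\<forall>N. norm (L - (\<Sum>n=1..N. \<chi> n * of_real (1 / real n))) \<le> B * (1 / real (Suc N)))"
    by (rule weighted_sum_tail) (auto simp: frac_le lim_1_over_n)
  then obtain L where L: "(\<lambda>N. \<Sum>n=1..N. \<chi> n / of_nat n) \<longlonglongrightarrow> L"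
      "\<And>N. norm (L - (\<Sum>n=1..N. \<chi> n / of_nat n)) \<le> B * (1 / real (Suc N))"
    unfolding eq by blast
  then have "L = L1" by (simp add: L1_def limI)
  with L show "(\<lambda>N. \<Sum>n=1..N. \<chi> n / of_nat n) \<longlonglongrightarrow> L1"
    "norm (L1 - (\<Sum>n=1..N. \<chi> n / of_nat n)) \<le> B / real (Suc N)" by auto
qed

section \<open>Moebius convolutions twisted by a character\<close>

text \<open>Complete multiplicativity splits \<open>\<chi> n / n\<close> along
  \<open>n = d * k\<close>, after which the sums are exchanged.\<close>

lemma divisor_sum_convolution:
  "(\<Sum>n=1..N. \<chi> n / of_nat n * (\<Sum>d | d dvd n. a d * h (n div d))) =
    (\<Sum>d=1..N. a d * \<chi> d / of_nat d * (\<Sum>k=1..N div d. \<chi> k / of_nat k * h k))"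
proof -
  have "(\<Sum>n=1..N. \<chi> n / of_nat n * (\<Sum>d | d dvd n. a d * h (n div d))) =
      (\<Sum>n=1..N. \<Sum>d | d dvd n. a d * \<chi> d / of_nat d * (\<chi> (n div d) / of_nat (n div d) * h (n div d)))"
  proof (intro sum.cong refl)
    fix n assume "n \<in> {1..N}"
    then have n: "n > 0" by simp
    have "\<chi> n / of_nat n * (a d * h (n div d)) =
        a d * \<chi> d / of_nat d * (\<chi> (n div d) / of_nat (n div d) * h (n div d))" if "d dvd n" for d
    proof -
      obtain k where "n = d * k" using \<open>d dvd n\<close> by blast
      with n show ?thesis by (simp add: mult)
    qed
    then show "\<chi> n / of_nat n * (\<Sum>d | d dvd n. a d * h (n div d)) =
        (\<Sum>d | d dvd n. a d * \<chi> d / of_nat d * (\<chi> (n div d) / of_nat (n div d) * h (n div d)))"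
      by (auto simp: sum_distrib_left intro!: sum.cong)
  qed
  also have "\<dots> = (\<Sum>d=1..N. \<Sum>k=1..N div d. a d * \<chi> d / of_nat d * (\<chi> k / of_nat k * h k))"
    by (rule sum_divisor_pairs_upto)
  finally show ?thesis by (simp add: sum_distrib_left)
qed

lemma norm_moebius_weight_le: "norm (moebius_mu d * \<chi> d / of_nat d) \<le> 1 / real d"
  using norm_moebius_mu_le[of d, where ?'a = complex] norm_le_1[of d]
  by (simp add: norm_mult norm_divide divide_right_mono mult_le_one)

text \<open>After the convolution, \<open>d\<close> is paired with a partial sum up to
  \<open>N div d\<close>. Replacing it by \<open>L\<close> costs
  \<open>B * H (N / d) / (N / d)\<close>, and the weight \<open>1 / d\<close> turns this into
  \<open>B * H (N / d) / N\<close>. It is applied with \<open>H x = 1\<close> and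
  \<open>H x = 1 + ln x\<close>.\<close>

lemma mu_sum_convolution_error:
  fixes H :: "real \<Rightarrow> real"
  assumes antimono: "\<And>x y. 1 \<le> x \<Longrightarrow> x \<le> y \<Longrightarrow> H y / y \<le> H x / x"
    and nonneg: "\<And>x. 1 \<le> x \<Longrightarrow> 0 \<le> H x"
    and tail: "\<And>N. norm (L - (\<Sum>n=1..N. \<chi> n / of_nat n * of_real (H n))) \<le> B * (H (Suc N) / real (Suc N))"
    and "N > 0"
  shows "norm (L * mu_sum N -
      (\<Sum>n=1..N. \<chi> n / of_nat n * (\<Sum>d | d dvd n. moebius_mu d * of_real (H (n div d)))))
    \<le> B * (\<Sum>d=1..N. H (real N / real d)) / real N"
proof -
  let ?a = "\<lambda>d. moebius_mu d * \<chi> d / of_nat d"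
  let ?T = "\<lambda>d. \<Sum>k=1..N div d. \<chi> k / of_nat k * of_real (H k)"
  have "L * mu_sum N - (\<Sum>n=1..N. \<chi> n / of_nat n * (\<Sum>d | d dvd n. moebius_mu d * of_real (H (n div d)))) =
      (\<Sum>d=1..N. ?a d * (L - ?T d))"
    using divisor_sum_convolution[of moebius_mu "\<lambda>k. of_real (H (real k))" N]
    by (simp add: mu_sum_def sum_distrib_left sum_subtractf algebra_simps)
  also have "norm \<dots> \<le> (\<Sum>d=1..N. 1 / real d * (B * (H (real N / real d) / (real N / real d))))"
  proof (rule sum_norm_le)
    fix d assume d: "d \<in> {1..N}"
    have "H (real (Suc (N div d))) / real (Suc (N div d)) \<le> H (real N / real d) / (real N / real d)"
      using d real_divide_less_Suc_div[of d N] by (intro antimono) auto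
    then have "norm (L - ?T d) \<le> B * (H (real N / real d) / (real N / real d))"
      using order_trans[OF tail[of "N div d"]] B_nonneg by (meson mult_left_mono)
    then show "norm (?a d * (L - ?T d)) \<le> 1 / real d * (B * (H (real N / real d) / (real N / real d)))"
      unfolding norm_mult[of "?a d"] by (intro mult_mono norm_moebius_weight_le) auto
  qed
  also have "\<dots> = B * (\<Sum>d=1..N. H (real N / real d)) / real N"
    using \<open>N > 0\<close> by (simp add: sum_distrib_left sum_divide_distrib mult_ac)
  finally show ?thesis .
qed

text \<open>With \<open>H x = 1\<close> the Moebius sums collapse to the term \<open>n = 1\<close>,
  so \<open>L1 * mu_sum N\<close> lies within \<open>B\<close> of 1.\<close>

lemma mu_sum_bounded:
  assumes "L1 \<noteq> 0" "N > 0"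
  shows "norm (mu_sum N) \<le> (1 + B) / norm L1"
proof -
  have "(\<Sum>n=1..N. \<chi> n / of_nat n * (\<Sum>d | d dvd n. moebius_mu d)) =
      (\<Sum>n=1..N. if n = 1 then 1 else 0)"
    by (intro sum.cong) (auto simp: sum_moebius_mu_divisors)
  also have "\<dots> = 1" using assms by (simp add: sum.delta)
  finally have "norm (L1 * mu_sum N - 1) \<le> B"
    using mu_sum_convolution_error[of "\<lambda>_. 1" L1 N] norm_L1_tail assms by (simp add: frac_le)
  then have "norm (L1 * mu_sum N) \<le> 1 + B"
    using norm_triangle_ineq2[of "L1 * mu_sum N" 1] by simp
  then show ?thesis using assms by (simp add: norm_mult field_simps)
qed

text \<open>
  The weight \<open>(1 + ln n) / n\<close> replaces \<open>ln n / n\<close> because it decreases from \<open>n = 1\<close> on.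
\<close>

lemma mangoldt_sum_bounded:
  assumes "L1 \<noteq> 0"
  shows "\<exists>C. \<forall>N. norm (\<Sum>n=1..N. \<chi> n * mangoldt n / of_nat n) \<le> C"
proof -
  have "(\<lambda>n. (1 + ln (real n)) / real n) \<longlonglongrightarrow> 0 + 0"
    unfolding add_divide_distrib
    by (intro tendsto_add lim_1_over_n filterlim_compose[OF ln_x_over_x_tendsto_0 filterlim_real_sequentially])
  then have "\<exists>L. (\<lambda>N. \<Sum>n=1..N. \<chi> n * of_real ((1 + ln (real n)) / real n)) \<longlonglongrightarrow> L \<and>
      (\<forall>N. norm (L - (\<Sum>n=1..N. \<chi> n * of_real ((1 + ln (real n)) / real n)))
        \<le> B * ((1 + ln (real (Suc N))) / real (Suc N)))"
    by (intro weighted_sum_tail antimono_one_plus_ln_div divide_nonneg_pos) auto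
  then obtain L where L: "\<And>N. norm (L - (\<Sum>n=1..N. \<chi> n * of_real ((1 + ln (real n)) / real n)))
      \<le> B * ((1 + ln (real (Suc N))) / real (Suc N))"
    by blast
  have bound: "norm (\<Sum>n=1..N. \<chi> n * mangoldt n / of_nat n) \<le> norm L * ((1 + B) / norm L1) + 2 * B + 1"
    if "N > 0" for N
  proof -
    let ?S = "\<Sum>n=1..N. \<chi> n * mangoldt n / of_nat n"
    \<comment> \<open>Moebius inversion turns the summand 1 into the indicator of
      \<open>n = 1\<close> and the logarithm into \<open>mangoldt\<close>.\<close>
    have "(\<Sum>n=1..N. \<chi> n / of_nat n * (\<Sum>d | d dvd n. moebius_mu d * of_real (1 + ln (n div d)))) =
        (\<Sum>n=1..N. (if n = 1 then 1 else 0) + \<chi> n * mangoldt n / of_nat n)"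
    proof (intro sum.cong refl)
      fix n assume "n \<in> {1..N}"
      then have n: "n > 0" by simp
      have "(\<Sum>d | d dvd n. moebius_mu d * complex_of_real (1 + ln (n div d))) =
          (\<Sum>d | d dvd n. moebius_mu d) + of_real (\<Sum>d | d dvd n. moebius_mu d * ln (n div d))"
        by (simp add: distrib_left sum.distrib)
      also have "\<dots> = (if n = 1 then 1 else 0) + mangoldt n"
        using n by (simp add: sum_moebius_mu_divisors sum_moebius_mu_ln)
      finally show "\<chi> n / of_nat n * (\<Sum>d | d dvd n. moebius_mu d * of_real (1 + ln (n div d))) =
          (if n = 1 then 1 else 0) + \<chi> n * mangoldt n / of_nat n"
        by auto
    qed
    also have "\<dots> = 1 + ?S"
      using that by (simp add: sum.distrib sum.delta)
    finally have eq: "(\<Sum>n=1..N. \<chi> n / of_nat n *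
      (\<Sum>d | d dvd n. moebius_mu d * of_real (1 + ln (n div d)))) = 1 + ?S" .
    have "(\<Sum>d=1..N. 1 + ln (real N / real d)) \<le> 2 * real N"
      using sum_ln_ratio_le[of N] by (simp add: sum.distrib)
    then have "B * (\<Sum>d=1..N. 1 + ln (real N / real d)) / real N \<le> B * (2 * real N) / real N"
      using B_nonneg by (intro divide_right_mono mult_left_mono) auto
    moreover have "norm (L * mu_sum N - (1 + ?S)) \<le> B * (\<Sum>d=1..N. 1 + ln (real N / real d)) / real N"
      unfolding eq[symmetric]
    proof (rule mu_sum_convolution_error)
      show "norm (L - (\<Sum>n=1..N. \<chi> n / of_nat n * of_real (1 + ln (real n))))
          \<le> B * ((1 + ln (real (Suc N))) / real (Suc N))" for N
        using L[of N] by simp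
    qed (use that antimono_one_plus_ln_div in auto)
    ultimately have "norm (L * mu_sum N - (1 + ?S)) \<le> 2 * B"
      using that by simp
    moreover have "norm (L * mu_sum N) \<le> norm L * ((1 + B) / norm L1)"
      unfolding norm_mult by (intro mult_left_mono mu_sum_bounded assms that) auto
    moreover have "norm ?S \<le> norm (L * mu_sum N) + norm (L * mu_sum N - (1 + ?S)) + 1"
      using norm_triangle_ineq4[of "L * mu_sum N" "L * mu_sum N - (1 + ?S)"]
        norm_triangle_ineq2[of "1 + ?S" 1] norm_triangle_ineq4[of "1 + ?S" 1] by simp
    ultimately show ?thesis by linarith
  qed
  have "norm (\<Sum>n=1..N. \<chi> n * mangoldt n / of_nat n) \<le> norm L * ((1 + B) / norm L1) + 2 * B + 1" for N
    using bound[of N] bound[of 1] by (cases "N = 0") (auto)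
  then show ?thesis by blast
qed

text \<open>Convolve \<open>moebius_mu d * ln (N / d)\<close> with 1. Splitting
  \<open>ln (N / d) = ln (N / n) + ln (n / d)\<close> produces \<open>ln N\<close> at
  \<open>n = 1\<close> plus the \<open>mangoldt\<close> terms. When \<open>L1 = 0\<close>, each
  inner partial sum is minus its own tail, hence at most \<open>B * d / N\<close> in norm, and
  \<open>sum_ln_ratio_le\<close> bounds the total.\<close>

lemma mangoldt_sum_asymptotics:
  assumes "L1 = 0" "N > 0"
  shows "norm (of_real (ln N) + (\<Sum>n=1..N. \<chi> n * mangoldt n / of_nat n)) \<le> B"
proof -
  let ?S = "\<Sum>n=1..N. \<chi> n * mangoldt n / of_nat n"
  let ?a = "\<lambda>d. moebius_mu d * \<chi> d / of_nat d"
  let ?T = "\<lambda>d. \<Sum>k=1..N div d. \<chi> k / of_nat k"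
  have "(\<Sum>n=1..N. \<chi> n / of_nat n * (\<Sum>d | d dvd n. (moebius_mu d * of_real (ln (N / d))) * 1)) =
      (\<Sum>n=1..N. (if n = 1 then of_real (ln N) else 0) + \<chi> n * mangoldt n / of_nat n)"
  proof (intro sum.cong refl)
    fix n assume "n \<in> {1..N}"
    then have n: "n > 0" by simp
    have ln_split: "ln (real N / real d) = ln (real N / real n) + ln (real (n div d))" if "d dvd n" for d
      using that n assms(2) by (auto elim!: dvdE simp: ln_mult ln_div)
    have "(\<Sum>d | d dvd n. moebius_mu d * complex_of_real (ln (N / d))) =
        (\<Sum>d | d dvd n. of_real (ln (real N / real n)) * moebius_mu d +
          moebius_mu d * of_real (ln (n div d)))"
      by (intro sum.cong refl) (subst ln_split, simp_all add: distrib_left mult.commute)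
    also have "\<dots> = of_real (ln (real N / real n)) * (\<Sum>d | d dvd n. moebius_mu d) +
        of_real (\<Sum>d | d dvd n. moebius_mu d * ln (n div d))"
      by (simp add: sum_distrib_left sum.distrib)
    also have "\<dots> = (if n = 1 then of_real (ln N) else 0) + mangoldt n"
      using n by (simp add: sum_moebius_mu_divisors sum_moebius_mu_ln)
    finally show "\<chi> n / of_nat n * (\<Sum>d | d dvd n. (moebius_mu d * of_real (ln (N / d))) * 1) =
        (if n = 1 then of_real (ln N) else 0) + \<chi> n * mangoldt n / of_nat n"
      by auto
  qed
  also have "\<dots> = of_real (ln N) + ?S"
    using assms by (simp add: sum.distrib sum.delta)
  finally have "of_real (ln N) + ?S = (\<Sum>d=1..N. ?a d * (of_real (ln (N / d)) * ?T d))"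
    using divisor_sum_convolution[of "\<lambda>d. moebius_mu d * of_real (ln (N / d))" "\<lambda>_. 1" N]
    by (simp add: mult_ac)
  also have "norm \<dots> \<le> (\<Sum>d=1..N. 1 / real d * (ln (N / d) * (B / (real N / real d))))"
  proof (rule sum_norm_le)
    fix d assume d: "d \<in> {1..N}"
    have "norm (?T d) \<le> B / real (Suc (N div d))"
      using norm_L1_tail[of "N div d"] assms(1) by (simp add: norm_minus_commute)
    also have "\<dots> \<le> B / (real N / real d)"
      using d real_divide_less_Suc_div[of d N] B_nonneg by (intro divide_left_mono) auto
    finally have "norm (of_real (ln (N / d)) * ?T d) \<le> ln (N / d) * (B / (real N / real d))"
      using d by (simp only: norm_mult norm_of_real) (intro mult_mono, auto)
    then show "norm (?a d * (of_real (ln (N / d)) * ?T d)) \<le> 1 / real d * (ln (N / d) * (B / (real N / real d)))"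
      unfolding norm_mult[of "?a d"] by (intro mult_mono norm_moebius_weight_le) auto
  qed
  also have "\<dots> = B * (\<Sum>d=1..N. ln (real N / real d)) / real N"
    using assms by (simp add: sum_distrib_left sum_divide_distrib mult_ac)
  also have "\<dots> \<le> B * real N / real N"
    using B_nonneg sum_ln_ratio_le[of N] by (intro divide_right_mono mult_left_mono) auto
  finally show ?thesis using assms by simp
qed

end

section \<open>Nonvanishing for real characters\<close>

lemma
  fixes c :: real
  assumes "c \<in> {-1, 0, 1}"
  shows sum_powers_sign_nonneg: "(\<Sum>i\<le>k. c ^ i) \<ge> 0"
    and sum_powers_sign_even: "even k \<Longrightarrow> (\<Sum>i\<le>k. c ^ i) \<ge> 1"
proof -
  have "(\<Sum>i\<le>k. (-1) ^ i :: real) = (if even k then 1 else 0)"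
    by (induction k) auto
  moreover have "(\<Sum>i\<le>k. 0 ^ i :: real) = 1"
    by (induction k) auto
  ultimately show "(\<Sum>i\<le>k. c ^ i) \<ge> 0" "even k \<Longrightarrow> (\<Sum>i\<le>k. c ^ i) \<ge> 1"
    using assms by auto
qed

section \<open>Divisor sums of a real character\<close>

context
  fixes f :: "nat \<Rightarrow> real"
  assumes f_one: "f (Suc 0) = 1" and f_mult: "\<And>a b. f (a * b) = f a * f b"
    and f_sign: "\<And>n. f n \<in> {-1, 0, 1}"
begin

lemma sign_character_power: "f (n ^ k) = f n ^ k"
  by (induction k) (auto simp: f_one f_mult)

lemma sum_divisors_sign_character_prime_power_mult:
  assumes "prime p" "\<not> p dvd m" "m > 0"
  shows "(\<Sum>d | d dvd p ^ k * m. f d) = (\<Sum>i\<le>k. f p ^ i) * (\<Sum>d | d dvd m. f d)"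
  using sum_divisors_prime_power_mult[of p m f k] assms by (simp add: f_mult sign_character_power)

text \<open>The divisor sum is a product over primes of sums of powers of \<open>f p\<close>, each
  nonnegative for \<open>f p\<close> in -1, 0, 1; the induction peels off one prime at a
  time.\<close>

lemma sum_divisors_sign_character_nonneg:
  assumes "n > 0"
  shows "(\<Sum>d | d dvd n. f d) \<ge> 0"
  using assms
proof (induction n rule: less_induct)
  case (less n)
  show ?case
  proof (cases "n = 1")
    case False
    then obtain p where p: "prime p" "p dvd n" using prime_factor_nat by blast
    obtain m where m: "n = p ^ multiplicity p n * m" "\<not> p dvd m"
      using multiplicity_decompose'[of n p] less.prems p by (metis less_not_refl not_prime_unit)
    have m0: "m > 0" using m less.prems by (metis gr0I mult_0_right less_not_refl)
    have "m < n"
      using p m m0 by (metis dvd_imp_le le_neq_implies_less dvd_triv_right less.prems)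
    then have "(\<Sum>d | d dvd m. f d) \<ge> 0" using less.IH m0 by blast
    then show ?thesis
      using m m0 p sum_powers_sign_nonneg[OF f_sign]
        sum_divisors_sign_character_prime_power_mult[of p m "multiplicity p n"] by simp
  qed (simp add: f_one)
qed

text \<open>In a square every prime has even exponent, so each local factor is at least 1.\<close>

lemma sum_divisors_sign_character_square:
  assumes "n > 0"
  shows "(\<Sum>d | d dvd n ^ 2. f d) \<ge> 1"
  using assms
proof (induction n rule: less_induct)
  case (less n)
  show ?case
  proof (cases "n = 1")
    case False
    then obtain p where p: "prime p" "p dvd n" using prime_factor_nat by blast
    obtain m where m: "n = p ^ multiplicity p n * m" "\<not> p dvd m"
      using multiplicity_decompose'[of n p] less.prems p by (metis less_not_refl not_prime_unit)
    have m0: "m > 0" using m less.prems by (metis gr0I mult_0_right less_not_refl)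
    have "m < n"
      using p m m0 by (metis dvd_imp_le le_neq_implies_less dvd_triv_right less.prems)
    then have "(\<Sum>d | d dvd m ^ 2. f d) \<ge> 1" using less.IH m0 by blast
    moreover have "n ^ 2 = p ^ (2 * multiplicity p n) * m ^ 2"
      by (subst m(1)) (simp add: power_mult_distrib power_even_eq)
    moreover have "\<not> p dvd m ^ 2" using m(2) p prime_dvd_power by blast
    moreover have "1 * 1 \<le> (\<Sum>i\<le>2 * multiplicity p n. f p ^ i) * (\<Sum>d | d dvd m ^ 2. f d)"
      using calculation(1) sum_powers_sign_even[OF f_sign] sum_powers_sign_nonneg[OF f_sign]
      by (intro mult_mono) auto
    ultimately show ?thesis
      using m0 p sum_divisors_sign_character_prime_power_mult[of p "m ^ 2" "2 * multiplicity p n"]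
      by simp
  qed (simp add: f_one)
qed

end

section \<open>Monsky's Lambert series argument\<close>

text \<open>Pair the exponent \<open>2 * i\<close> with its mirror image
  \<open>2 * (n - Suc i)\<close>; by AM-GM each pair is at least
  \<open>2 * u ^ (n - 1)\<close>.\<close>

lemma sum_even_powers_ge:
  fixes u :: real
  assumes "u > 0"
  shows "(\<Sum>i<n. u ^ (2 * i)) \<ge> real n * u ^ (n - 1)"
proof -
  have "2 * (\<Sum>i<n. u ^ (2 * i)) = (\<Sum>i<n. u ^ (2 * i)) + (\<Sum>i<n. u ^ (2 * (n - Suc i)))"
    by (simp add: sum.nat_diff_reindex[of "\<lambda>i. u ^ (2 * i)"])
  also have "\<dots> = (\<Sum>i<n. (u ^ i) ^ 2 + (u ^ (n - Suc i)) ^ 2)"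
    by (simp add: sum.distrib power_even_eq)
  also have "\<dots> \<ge> (\<Sum>i<n. 2 * (u ^ i * u ^ (n - Suc i)))"
    by (intro sum_mono) (metis mult.assoc sum_squares_bound)
  also have "(\<Sum>i<n. 2 * (u ^ i * u ^ (n - Suc i))) = (\<Sum>i<n. 2 * u ^ (n - 1))"
    by (intro sum.cong) (auto simp flip: power_add)
  finally show ?thesis by simp
qed

text \<open>
  Writing \<open>1 - t ^ n = (1 - t) * S n\<close>, monotonicity amounts to
  \<open>n * (n + 1) * t ^ n \<le> S n * S (n + 1)\<close>, which is AM-GM for the two geometric sums; the
  parameter is a square \<open>t = u ^ 2\<close> to avoid fractional exponents.
\<close>

lemma lambert_weight_antimono:
  fixes u :: real
  assumes u: "0 < u" "u < 1" and n: "n \<ge> 1"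
  defines "t \<equiv> u ^ 2"
  defines "b \<equiv> \<lambda>n. 1 / (real n * (1 - t)) - t ^ n / (1 - t ^ n)"
  shows "b n \<ge> 0" and "b (Suc n) \<le> b n"
proof -
  have t: "0 < t" "t < 1" using u by (auto simp: t_def power_less_one_iff)
  define S where "S = (\<lambda>n. \<Sum>i<n. t ^ i)"
  have S: "1 - t ^ n = (1 - t) * S n" for n
    using sum_gp_strict[of t n] t by (simp add: S_def)
  have Spos: "S k > 0" if "k \<ge> 1" for k
    using that t unfolding S_def by (intro sum_pos) (auto simp: lessThan_empty_iff)
  have Sge: "S k \<ge> real k * u ^ (k - 1)" for k
    using sum_even_powers_ge[of u k] u by (simp add: S_def t_def power_mult)
  have pow: "S n * S (Suc n) \<ge> real n * real (Suc n) * t ^ n"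
  proof -
    have "t ^ n \<le> u ^ (n - 1) * u ^ n"
      using u n unfolding t_def power_mult[symmetric] power_add[symmetric] by (intro power_decreasing) auto
    then have "real n * real (Suc n) * t ^ n \<le> (real n * u ^ (n - 1)) * (real (Suc n) * u ^ n)"
      by (simp add: mult_ac mult_left_mono)
    also have "\<dots> \<le> S n * S (Suc n)"
      using Sge[of n] Sge[of "Suc n"] Spos[of n] n u by (intro mult_mono) auto
    finally show ?thesis .
  qed
  have "real n * t ^ n \<le> S n"
  proof -
    have "t ^ n \<le> u ^ (n - 1)"
      using u unfolding t_def power_mult[symmetric] by (intro power_decreasing) auto
    then show ?thesis using Sge[of n] by (meson mult_left_mono of_nat_0_le_iff order_trans)
  qed
  then have "t ^ n / S n \<le> 1 / real n" using Spos[OF n] n by (simp add: field_simps)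
  then have "(t ^ n / S n) / (1 - t) \<le> (1 / real n) / (1 - t)"
    using t by (intro divide_right_mono) auto
  then show "b n \<ge> 0" by (simp add: b_def S mult.commute)
  \<comment> \<open>The numerator collapses because \<open>S (Suc n) - t * S n = 1\<close>, so
    \<open>pow\<close> compares the decrement with that of \<open>1 / n\<close>.\<close>
  have "t ^ n / S n - t ^ Suc n / S (Suc n) = t ^ n * (S (Suc n) - t * S n) / (S n * S (Suc n))"
    using Spos[of n] Spos[of "Suc n"] n by (simp add: field_simps)
  also have "S (Suc n) - t * S n = 1"
    using S[of n] by (simp add: S_def algebra_simps)
  also have "t ^ n * 1 / (S n * S (Suc n)) \<le> 1 / (real n * real (Suc n))"
    using pow Spos[of n] Spos[of "Suc n"] n by (simp add: field_simps del: of_nat_Suc)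
  also have "\<dots> = 1 / real n - 1 / real (Suc n)"
    using n by (simp add: field_simps)
  finally have "(t ^ n / S n - t ^ Suc n / S (Suc n)) / (1 - t) \<le> (1 / real n - 1 / real (Suc n)) / (1 - t)"
    using t by (intro divide_right_mono) auto
  then show "b (Suc n) \<le> b n"
    unfolding b_def S by (simp add: diff_divide_distrib mult.commute del: of_nat_Suc power_Suc)
qed

text \<open>
  Following Monsky: the Lambert series of \<open>f\<close> at \<open>t\<close> has coefficients \<open>A n \<ge> 0\<close> that are at
  least 1 at squares, so it is unbounded as \<open>t\<close> tends to 1. If the sum of \<open>f n / n\<close> vanishes,
  subtracting it divided by \<open>1 - t\<close> turns the weights into a decreasing sequence starting at 1,
  and the series is bounded by \<open>B\<close>.
\<close>

lemma sign_character_sum_nonzero: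
  fixes f :: "nat \<Rightarrow> real"
  assumes f_one: "f (Suc 0) = 1" and f_mult: "\<And>a b. f (a * b) = f a * f b"
    and f_sign: "\<And>n. f n \<in> {-1, 0, 1}"
    and bounded: "\<And>M N. \<bar>\<Sum>n=M..<N. f n\<bar> \<le> B"
    and lim0: "(\<lambda>N. \<Sum>n=1..N. f n / real n) \<longlonglongrightarrow> 0"
  shows False
proof -
  define A where "A = (\<lambda>n. \<Sum>d | d dvd n. f d)"
  have A_nonneg: "A n \<ge> 0" if "n > 0" for n
    using sum_divisors_sign_character_nonneg[OF f_one f_mult f_sign that] by (simp add: A_def)
  have A_square: "A (k ^ 2) \<ge> 1" if "k > 0" for k
    using sum_divisors_sign_character_square[OF f_one f_mult f_sign that] by (simp add: A_def)
  have f_le: "\<bar>f n\<bar> \<le> 1" for n using f_sign[of n] by auto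
  have squares: "(\<Sum>k=1..K. (u ^ 2) ^ (k ^ 2)) \<le> B" if u: "0 < u" "u < 1" for u :: real and K :: nat
  proof -
    define t where "t = u ^ 2"
    have t: "0 < t" "t < 1" using u by (auto simp: t_def power_less_one_iff)
    define b where "b = (\<lambda>n. 1 / (real n * (1 - t)) - t ^ n / (1 - t ^ n))"
    have tn: "t ^ n \<le> t" if "n \<ge> 1" for n
      using power_decreasing[of 1 n t] that t by simp
    have upper: "(\<Sum>n=1..M. A n * t ^ n) \<le>
        \<bar>\<Sum>n=1..M. f n / real n\<bar> / (1 - t) + B + (real M * t ^ M) / (1 - t)" if "M \<ge> 1" for M
    proof -
      \<comment> \<open>All sums stay finite: cutting the geometric series of \<open>t ^ a\<close>
        at \<open>M div a\<close> leaves the error \<open>?E\<close>, which is at most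
        \<open>M * t ^ M / (1 - t)\<close>.\<close>
      let ?E = "\<Sum>a=1..M. f a * (t ^ (a * Suc (M div a)) / (1 - t ^ a))"
      have "(\<Sum>n=1..M. A n * t ^ n) = (\<Sum>n=1..M. \<Sum>d | d dvd n. f d * t ^ (d * (n div d)))"
        by (simp add: A_def sum_distrib_right)
      also have "\<dots> = (\<Sum>a=1..M. \<Sum>k=1..M div a. f a * t ^ (a * k))"
        by (rule sum_divisor_pairs_upto)
      also have "\<dots> = (\<Sum>a=1..M. f a * (t ^ a / (1 - t ^ a)) - f a * (t ^ (a * Suc (M div a)) / (1 - t ^ a)))"
      proof (intro sum.cong refl)
        fix a assume a: "a \<in> {1..M}"
        then have "t ^ a \<noteq> 1" using tn[of a] t by auto
        have "(\<Sum>k=1..M div a. f a * t ^ (a * k)) = f a * (\<Sum>k=1..M div a. (t ^ a) ^ k)"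
          by (simp add: sum_distrib_left power_mult)
        also have "(\<Sum>k=1..M div a. (t ^ a) ^ k) = ((t ^ a) ^ 1 - (t ^ a) ^ Suc (M div a)) / (1 - t ^ a)"
          using a \<open>t ^ a \<noteq> 1\<close> by (subst sum_gp) (auto simp: div_greater_zero_iff not_less)
        finally show "(\<Sum>k=1..M div a. f a * t ^ (a * k)) =
            f a * (t ^ a / (1 - t ^ a)) - f a * (t ^ (a * Suc (M div a)) / (1 - t ^ a))"
          unfolding power_mult by (simp add: diff_divide_distrib right_diff_distrib del: power_Suc)
      qed
      also have "\<dots> = (\<Sum>a=1..M. f a * (t ^ a / (1 - t ^ a))) - ?E"
        by (rule sum_subtractf)
      \<comment> \<open>Here the weight is split as \<open>1 / (a * (1 - t)) - b a\<close>; the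
        first part carries the sum of \<open>f a / a\<close>, which tends to 0.\<close>
      also have "(\<Sum>a=1..M. f a * (t ^ a / (1 - t ^ a))) =
          (\<Sum>a=1..M. f a / real a) / (1 - t) - (\<Sum>a=1..M. f a * b a)"
        by (simp add: b_def sum_divide_distrib sum_subtractf[symmetric] algebra_simps)
      finally have "(\<Sum>n=1..M. A n * t ^ n) =
          (\<Sum>a=1..M. f a / real a) / (1 - t) - (\<Sum>a=1..M. f a * b a) - ?E" .
      moreover have "\<bar>\<Sum>a=1..M. f a * b a\<bar> \<le> B"
      proof -
        have "norm (\<Sum>a=1..<Suc M. b a *\<^sub>R f a) \<le> B * b 1"
          using lambert_weight_antimono[OF u] that bounded
          by (intro norm_sum_antimono_weights_le) (auto simp: b_def t_def)
        moreover have "b 1 = 1"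
          using t by (simp add: b_def diff_divide_distrib[symmetric])
        ultimately show ?thesis by (simp add: atLeastLessThanSuc_atLeastAtMost mult.commute)
      qed
      moreover have "\<bar>?E\<bar> \<le> (\<Sum>a=1..M. 1 * (t ^ M / (1 - t)))"
        unfolding real_norm_def[symmetric]
      proof (rule sum_norm_le)
        fix a assume a: "a \<in> {1..M}"
        have "M \<le> a * Suc (M div a)"
          using dividend_less_times_div[of a M] a by simp
        then have "t ^ (a * Suc (M div a)) / (1 - t ^ a) \<le> t ^ M / (1 - t)"
          using tn[of a] t a by (intro frac_le power_decreasing) auto
        moreover have "0 \<le> t ^ (a * Suc (M div a)) / (1 - t ^ a)"
          using tn[of a] t a by (intro divide_nonneg_nonneg) auto
        ultimately show "norm (f a * (t ^ (a * Suc (M div a)) / (1 - t ^ a))) \<le> 1 * (t ^ M / (1 - t))"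
          using f_le[of a] unfolding real_norm_def abs_mult[of "f a"] by (intro mult_mono) (auto simp: abs_of_nonneg simp del: abs_divide)
      qed
      moreover have "(\<Sum>a=1..M. f a / real a) / (1 - t) \<le> \<bar>\<Sum>n=1..M. f n / real n\<bar> / (1 - t)"
        using t by (intro divide_right_mono) auto
      ultimately show ?thesis by simp
    qed
    \<comment> \<open>With \<open>t\<close> fixed and \<open>M\<close> tending to infinity, only
      \<open>B\<close> survives on the right.\<close>
    have "(\<lambda>M. \<bar>\<Sum>n=1..M. f n / real n\<bar> / (1 - t) + B + (real M * t ^ M) / (1 - t))
        \<longlonglongrightarrow> \<bar>0\<bar> / (1 - t) + B + 0 / (1 - t)"
      using t powser_times_n_limit_0[of t] by (intro tendsto_intros lim0) auto
    moreover have "\<forall>\<^sub>F M in sequentially. (\<Sum>k=1..K. t ^ (k ^ 2)) \<le>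
        \<bar>\<Sum>n=1..M. f n / real n\<bar> / (1 - t) + B + (real M * t ^ M) / (1 - t)"
      using eventually_ge_at_top[of "Suc (K ^ 2)"]
    proof eventually_elim
      case (elim M)
      have "(\<Sum>k=1..K. t ^ (k ^ 2)) \<le> (\<Sum>k=1..K. A (k ^ 2) * t ^ (k ^ 2))"
        using A_square t by (intro sum_mono) (simp add: mult_le_cancel_right1)
      also have "\<dots> = (\<Sum>n\<in>(\<lambda>k. k ^ 2) ` {1..K}. A n * t ^ n)"
        by (subst sum.reindex) (auto intro!: inj_onI)
      also have "\<dots> \<le> (\<Sum>n=1..M. A n * t ^ n)"
      proof (rule sum_mono2)
        have "k ^ 2 \<le> M" if "k \<le> K" for k
          using elim power_mono[OF that, of 2] by (simp del: power_mono_iff)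
        then show "(\<lambda>k. k ^ 2) ` {1..K} \<subseteq> {1..M}" by (auto simp: Suc_le_eq)
      qed (use A_nonneg t in auto)
      also have "\<dots> \<le> \<bar>\<Sum>n=1..M. f n / real n\<bar> / (1 - t) + B + (real M * t ^ M) / (1 - t)"
        using elim by (intro upper) auto
      finally show ?case .
    qed
    ultimately have "(\<Sum>k=1..K. t ^ (k ^ 2)) \<le> \<bar>0\<bar> / (1 - t) + B + 0 / (1 - t)"
      by (rule tendsto_lowerbound) simp
    then show ?thesis by (simp add: t_def)
  qed
  \<comment> \<open>The bound \<open>B\<close> is uniform in \<open>u\<close>, and each term tends
    to 1 as \<open>u\<close> tends to 1 from below.\<close>
  have "real K \<le> B" for K
  proof (rule tendsto_upperbound)
    have "((\<lambda>u::real. \<Sum>k=1..K. (u ^ 2) ^ (k ^ 2)) \<longlongrightarrow> (\<Sum>k=1..K. (1 ^ 2) ^ (k ^ 2))) (at_left 1)"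
      by (intro tendsto_intros)
    then show "((\<lambda>u::real. \<Sum>k=1..K. (u ^ 2) ^ (k ^ 2)) \<longlongrightarrow> real K) (at_left 1)"
      by simp
    show "\<forall>\<^sub>F u in at_left (1::real). (\<Sum>k=1..K. (u ^ 2) ^ (k ^ 2)) \<le> B"
      using eventually_at_left_real[OF zero_less_one]
      by (rule eventually_mono) (auto simp del: One_nat_def intro: squares)
  qed simp
  then show False using reals_Archimedean2[of B] by (meson not_le)
qed

section \<open>Dirichlet characters\<close>

text \<open>Characters are functions on all of \<open>nat\<close>, extended by 0 off the units, so
  products and conjugates are pointwise and equality is equality of functions.\<close>

definition dirichlet_char :: "nat \<Rightarrow> (nat \<Rightarrow> complex) \<Rightarrow> bool" where
  "dirichlet_char m \<chi> \<longleftrightarrow> (\<forall>a b. \<chi> (a * b) = \<chi> a * \<chi> b) \<and> (\<forall>n. \<chi> (n + m) = \<chi> n) \<and>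
    (\<forall>n. \<chi> n \<noteq> 0 \<longleftrightarrow> coprime n m)"

definition principal_char :: "nat \<Rightarrow> nat \<Rightarrow> complex" where
  "principal_char m n = (if coprime n m then 1 else 0)"

lemma coprime_add_self_nat: "coprime (n + m) m \<longleftrightarrow> coprime n (m :: nat)"
  by (simp add: coprime_iff_gcd_eq_1)

lemma dirichlet_charD:
  assumes "dirichlet_char m \<chi>"
  shows "\<chi> (a * b) = \<chi> a * \<chi> b" "\<chi> (n + m) = \<chi> n" "\<chi> n = 0 \<longleftrightarrow> \<not> coprime n m"
  using assms by (auto simp: dirichlet_char_def)

lemma dirichlet_char_one:
  assumes "dirichlet_char m \<chi>"
  shows "\<chi> (Suc 0) = 1"
  using dirichlet_charD(1)[OF assms, of 1 1] dirichlet_charD(3)[OF assms, of 1] by simp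

lemma dirichlet_char_mod:
  assumes "dirichlet_char m \<chi>"
  shows "\<chi> (n mod m) = \<chi> n"
proof -
  have "\<chi> (r + k * m) = \<chi> r" for r k
  proof (induction k)
    case (Suc k)
    then show ?case using dirichlet_charD(2)[OF assms, of "r + k * m"] by (simp add: algebra_simps)
  qed auto
  from this[of "n mod m" "n div m"] show ?thesis by simp
qed

lemma dirichlet_char_cong:
  assumes "dirichlet_char m \<chi>" "[a = b] (mod m)"
  shows "\<chi> a = \<chi> b"
  using assms dirichlet_char_mod by (metis cong_def)

lemma dirichlet_char_power:
  assumes "dirichlet_char m \<chi>"
  shows "\<chi> (a ^ k) = \<chi> a ^ k"
  by (induction k) (auto simp: dirichlet_char_one[OF assms] dirichlet_charD(1)[OF assms])

lemma dirichlet_char_power_totient: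
  assumes "dirichlet_char m \<chi>" "coprime n m"
  shows "\<chi> n ^ totient m = 1"
  using dirichlet_char_cong[OF assms(1) euler_theorem[OF assms(2)]] assms(1)
  by (simp add: dirichlet_char_power dirichlet_char_one)

lemma norm_dirichlet_char:
  assumes "dirichlet_char m \<chi>" "m > 0"
  shows "norm (\<chi> n) = (if coprime n m then 1 else 0)"
proof (cases "coprime n m")
  case True
  then have "norm (\<chi> n) = 1"
    using power_eq_1_iff[OF dirichlet_char_power_totient[OF assms(1) True]] assms(2) by simp
  with True show ?thesis by simp
qed (use dirichlet_charD(3)[OF assms(1)] in auto)

text \<open>A character is determined by its values below \<open>m\<close>, each of which is 0 or a
  root of unity of order dividing \<open>totient m\<close>.\<close>

lemma finite_dirichlet_chars:
  assumes "m > 0"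
  shows "finite {\<chi>. dirichlet_char m \<chi>}"
proof (rule finite_imageD)
  let ?R = "insert 0 {z::complex. z ^ totient m = 1}"
  have "finite ?R" using assms finite_roots_unity[of "totient m", where ?'a = complex] by (simp add: Suc_le_eq)
  then have "finite (PiE {..<m} (\<lambda>_. ?R))" by (intro finite_PiE) auto
  moreover have "(\<lambda>\<chi>. restrict \<chi> {..<m}) ` {\<chi>. dirichlet_char m \<chi>} \<subseteq> PiE {..<m} (\<lambda>_. ?R)"
    using dirichlet_char_power_totient dirichlet_charD(3) by (simp add: image_subset_iff)
  ultimately show "finite ((\<lambda>\<chi>. restrict \<chi> {..<m}) ` {\<chi>. dirichlet_char m \<chi>})"
    by (rule finite_subset[rotated])
  show "inj_on (\<lambda>\<chi>. restrict \<chi> {..<m}) {\<chi>. dirichlet_char m \<chi>}"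
  proof (rule inj_onI, rule ext)
    fix \<chi> \<psi> n assume *: "\<chi> \<in> {\<chi>. dirichlet_char m \<chi>}" "\<psi> \<in> {\<chi>. dirichlet_char m \<chi>}"
      "restrict \<chi> {..<m} = restrict \<psi> {..<m}"
    then have "\<chi> (n mod m) = \<psi> (n mod m)"
      using assms by (metis lessThan_iff mod_less_divisor restrict_apply')
    then show "\<chi> n = \<psi> n" using * dirichlet_char_mod by (metis mem_Collect_eq)
  qed
qed

lemma dirichlet_char_principal: "dirichlet_char m (principal_char m)"
  by (auto simp: dirichlet_char_def principal_char_def coprime_add_self_nat)

lemma dirichlet_char_mult:
  assumes "dirichlet_char m \<chi>" "dirichlet_char m \<psi>"
  shows "dirichlet_char m (\<lambda>n. \<chi> n * \<psi> n)"
  using assms by (simp add: dirichlet_char_def)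

lemma dirichlet_char_cnj:
  assumes "dirichlet_char m \<chi>"
  shows "dirichlet_char m (\<lambda>n. cnj (\<chi> n))"
  using assms by (simp add: dirichlet_char_def)

text \<open>Multiplication by a unit \<open>a\<close> with \<open>\<chi> a \<noteq> 1\<close>
  permutes the residues, so the sum equals \<open>\<chi> a\<close> times itself.\<close>

lemma sum_nonprincipal_char:
  assumes \<chi>: "dirichlet_char m \<chi>" and m: "m > 0" and np: "\<chi> \<noteq> principal_char m"
  shows "(\<Sum>n<m. \<chi> n) = 0"
proof -
  obtain a where "\<chi> a \<noteq> principal_char m a" using np by blast
  then have a: "coprime a m" "\<chi> a \<noteq> 1"
    using dirichlet_charD(3)[OF \<chi>, of a] by (auto simp: principal_char_def split: if_splits)
  have inj: "inj_on (\<lambda>n. a * n mod m) {..<m}"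
  proof (rule inj_onI)
    fix x y assume *: "x \<in> {..<m}" "y \<in> {..<m}" "a * x mod m = a * y mod m"
    then have "[a * x = a * y] (mod m)" by (simp add: cong_def)
    then have "[x = y] (mod m)" using a(1) cong_mult_lcancel_nat by (metis coprime_commute)
    then show "x = y" using * by (simp add: cong_def)
  qed
  have "(\<lambda>n. a * n mod m) ` {..<m} = {..<m}"
    using inj m by (intro endo_inj_surj) auto
  then have "(\<Sum>n<m. \<chi> n) = (\<Sum>n<m. \<chi> (a * n mod m))"
    using sum.reindex[OF inj, of \<chi>] by simp
  also have "\<dots> = \<chi> a * (\<Sum>n<m. \<chi> n)"
    by (simp add: dirichlet_char_mod[OF \<chi>] dirichlet_charD(1)[OF \<chi>] sum_distrib_left)
  finally show ?thesis using a(2) by (simp add: algebra_simps)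
qed

text \<open>Full periods sum to 0, so an initial sum reduces to fewer than \<open>m\<close> terms; a
  block is a difference of two initial sums, hence the factor 2.\<close>

lemma cancelling_character_nonprincipal:
  assumes \<chi>: "dirichlet_char m \<chi>" and m: "m > 0" and np: "\<chi> \<noteq> principal_char m"
  shows "cancelling_character \<chi> (2 * real m)"
proof
  have le1: "norm (\<chi> n) \<le> 1" for n using norm_dirichlet_char[OF \<chi> m] by simp
  then show "norm (\<chi> n) \<le> 1" for n .
  have per: "(\<Sum>n<N + m. \<chi> n) = (\<Sum>n<N. \<chi> n)" for N
    by (induction N) (simp_all add: sum_nonprincipal_char[OF assms] dirichlet_charD(2)[OF \<chi>])
  have "(\<Sum>n<r + k * m. \<chi> n) = (\<Sum>n<r. \<chi> n)" for r k
  proof (induction k)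
    case (Suc k)
    then show ?case using per[of "r + k * m"] by (simp add: algebra_simps)
  qed auto
  from this[of "N mod m" "N div m" for N] have "(\<Sum>n<N. \<chi> n) = (\<Sum>n<N mod m. \<chi> n)" for N by simp
  moreover have "norm (\<Sum>n<k. \<chi> n) \<le> real m" if "k < m" for k
  proof -
    have "norm (\<Sum>n<k. \<chi> n) \<le> (\<Sum>n<k. 1)" by (intro sum_norm_le le1)
    then show ?thesis using that by simp
  qed
  ultimately have initial: "norm (\<Sum>n<N. \<chi> n) \<le> real m" for N
    using m mod_less_divisor by metis
  show "norm (\<Sum>n=M..<N. \<chi> n) \<le> 2 * real m" for M N
  proof (cases "M \<le> N")
    case True
    then have "(\<Sum>n=M..<N. \<chi> n) = (\<Sum>n<N. \<chi> n) - (\<Sum>n<M. \<chi> n)"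
      using sum_diff_nat_ivl[of 0 M N \<chi>] by (simp add: atLeast0LessThan)
    then show ?thesis
      using norm_triangle_ineq4[of "\<Sum>n<N. \<chi> n" "\<Sum>n<M. \<chi> n"] initial[of N] initial[of M] by simp
  qed auto
qed (use dirichlet_char_one[OF \<chi>] dirichlet_charD(1)[OF \<chi>] in auto)

section \<open>Separating characters and orthogonality\<close>

text \<open>The unit group is cyclic: composing the discrete logarithm to a primitive root with an
  injective map to roots of unity gives a faithful character.\<close>

lemma exists_char_prime_modulus:
  assumes p: "prime p"
  shows "\<exists>\<chi>. dirichlet_char p \<chi> \<and> (\<forall>a. \<chi> a = 1 \<longrightarrow> [a = 1] (mod p))"
proof -
  obtain g where g: "residue_primroot p g" using prime_primitive_root_exists[OF prime_gt_1_nat[OF p]] p by blast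
  define q where "q = totient p"
  have p1: "p > 1" using p prime_gt_1_nat by blast
  have q: "q > 0" using p1 by (simp add: q_def)
  have cop: "coprime p g" and ord: "ord p g = q" using g by (auto simp: residue_primroot_def q_def)
  have gen: "\<exists>k. [g ^ k = a] (mod p)" if "coprime a p" for a
  proof -
    have "a mod p \<in> totatives p"
      using that p1 by (auto simp: totatives_def coprime_commute intro!: Nat.gr0I)
    then obtain k where "a mod p = g ^ k mod p"
      using residue_primroot_is_generator[OF p1 g] by (auto simp: bij_betw_def)
    then show ?thesis by (auto simp: cong_def)
  qed
  define e where "e = (\<lambda>k. cis (2 * pi * real k / real q))"
  have e_add: "e (k + l) = e k * e l" for k l
    by (simp add: e_def cis_mult add_divide_distrib algebra_simps)
  have e_period: "e (r + k * q) = e r" for r k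
  proof -
    have "e (k * q) = 1"
      using q cis_multiple_2pi[of "real k"] by (simp add: e_def mult.assoc)
    then show ?thesis by (simp add: e_add)
  qed
  have e_mod: "e (k mod q) = e k" for k
    using e_period[of "k mod q" "k div q"] by simp
  have e_cong: "e k = e l" if "[k = l] (mod q)" for k l
    using that e_mod by (metis cong_def)
  have e_eq_1: "[k = 0] (mod q)" if "e k = 1" for k
  proof -
    have "inj_on e {..<q}" using bij_betw_roots_unity[OF q] by (simp add: bij_betw_def e_def)
    moreover have "e (k mod q) = e 0" using that by (simp add: e_mod) (simp add: e_def)
    ultimately show ?thesis
      using q by (auto simp: inj_on_def cong_def)
  qed
  \<comment> \<open>An arbitrary discrete logarithm; \<open>e (ind a)\<close> is independent of the
    choice because exponents are determined modulo \<open>q\<close>.\<close>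
  define ind where "ind = (\<lambda>a. SOME k. [g ^ k = a] (mod p))"
  have ind: "[g ^ ind a = a] (mod p)" if "coprime a p" for a
    using someI_ex[OF gen[OF that]] by (simp add: ind_def)
  have e_ind: "e (ind a) = e k" if "[g ^ k = a] (mod p)" "coprime a p" for a k
  proof -
    have "[g ^ ind a = g ^ k] (mod p)" using ind[OF that(2)] that(1) by (metis cong_sym cong_trans)
    then show ?thesis using order_divides_expdiff[OF cop] ord e_cong by simp
  qed
  define \<chi> where "\<chi> = (\<lambda>a. if coprime a p then e (ind a) else 0)"
  have "\<chi> (a * b) = \<chi> a * \<chi> b" for a b
  proof (cases "coprime a p \<and> coprime b p")
    case True
    then have "[g ^ (ind a + ind b) = a * b] (mod p)"
      unfolding power_add using ind by (intro cong_mult) auto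
    with True show ?thesis using e_ind[of "ind a + ind b" "a * b"] by (simp add: \<chi>_def e_add)
  qed (auto simp: \<chi>_def)
  moreover have "\<chi> (a + p) = \<chi> a" for a
  proof (cases "coprime a p")
    case True
    then have "[g ^ ind a = a + p] (mod p)" using ind by (simp add: cong_def)
    with True show ?thesis using e_ind[of "ind a" "a + p"] by (simp add: \<chi>_def coprime_add_self_nat)
  qed (auto simp: \<chi>_def coprime_add_self_nat)
  moreover have "\<chi> a \<noteq> 0 \<longleftrightarrow> coprime a p" for a
    by (simp add: \<chi>_def e_def)
  moreover have "[a = 1] (mod p)" if "\<chi> a = 1" for a
  proof -
    have "coprime a p" "e (ind a) = 1" using that by (auto simp: \<chi>_def split: if_splits)
    then have "[g ^ ind a = g ^ 0] (mod p)"
      using e_eq_1 ord order_divides_expdiff[OF cop] by blast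
    with ind[OF \<open>coprime a p\<close>] show ?thesis by (metis cong_sym cong_trans power_0)
  qed
  ultimately show ?thesis unfolding dirichlet_char_def by blast
qed

text \<open>A squarefree \<open>m\<close> is the product of its distinct primes, so \<open>a\<close>
  differs from 1 modulo one of them, and a faithful character modulo that prime separates the
  two.\<close>

lemma exists_char_neq_1:
  assumes m: "squarefree m" and a: "coprime a m" "\<not> [a = 1] (mod m)"
  shows "\<exists>\<chi>. dirichlet_char m \<chi> \<and> \<chi> a \<noteq> 1"
proof -
  have m0: "m \<noteq> 0" using m by (auto intro: Nat.gr0I)
  have "(\<Prod>p\<in>prime_factors m. p) = (\<Prod>p\<in>prime_factors m. p ^ multiplicity p m)"
    using m m0 by (intro prod.cong) (auto simp: squarefree_factorial_semiring')
  also have "\<dots> = m" using prod_prime_factors[OF m0] by simp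
  finally have "(\<Prod>p\<in>prime_factors m. p) = m" .
  moreover have "coprime p q" if "p \<in> prime_factors m" "q \<in> prime_factors m" "p \<noteq> q" for p q
    using that by (auto intro: primes_coprime)
  ultimately obtain p where p: "p \<in> prime_factors m" "\<not> [a = 1] (mod p)"
    using a(2) coprime_cong_prod_nat[of "prime_factors m" "\<lambda>p. p" a 1] by metis
  obtain \<chi> where \<chi>: "dirichlet_char p \<chi>" "\<And>a. \<chi> a = 1 \<Longrightarrow> [a = 1] (mod p)"
    using exists_char_prime_modulus[of p] p by auto
  obtain k where k: "m = p * k" using p by (auto simp: in_prime_factors_iff)
  \<comment> \<open>The character modulo \<open>p\<close> must be cut to 0 at numbers sharing
    another prime with \<open>m\<close>.\<close>
  define \<psi> where "\<psi> = (\<lambda>n. if coprime n m then \<chi> n else 0)"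
  have "\<chi> (n + m) = \<chi> n" for n
    using k by (intro dirichlet_char_cong[OF \<chi>(1)]) (simp add: cong_def)
  moreover have "\<chi> n \<noteq> 0" if "coprime n m" for n
    using that k dirichlet_charD(3)[OF \<chi>(1)] by simp
  ultimately have "dirichlet_char m \<psi>"
    using dirichlet_charD(1)[OF \<chi>(1)] by (auto simp: dirichlet_char_def \<psi>_def coprime_add_self_nat)
  moreover have "\<psi> a \<noteq> 1" using p(2) \<chi>(2) a(1) by (auto simp: \<psi>_def)
  ultimately show ?thesis by blast
qed

text \<open>Orthogonality: multiplying by a character with \<open>\<psi> a \<noteq> 1\<close>
  permutes all characters, so the sum equals \<open>\<psi> a\<close> times itself.\<close>

lemma sum_chars:
  assumes m: "squarefree m"
  shows "(\<Sum>\<chi> | dirichlet_char m \<chi>. \<chi> a) =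
    (if [a = 1] (mod m) then of_nat (card {\<chi>. dirichlet_char m \<chi>}) else 0)"
proof -
  have m0: "m > 0" using m by (auto intro: Nat.gr0I)
  let ?X = "{\<chi>. dirichlet_char m \<chi>}"
  consider "[a = 1] (mod m)" | "\<not> [a = 1] (mod m)" "coprime a m" | "\<not> coprime a m"
    by blast
  then show ?thesis
  proof cases
    case 1
    then have "(\<Sum>\<chi>\<in>?X. \<chi> a) = (\<Sum>\<chi>\<in>?X. 1)"
      by (intro sum.cong refl) (metis One_nat_def mem_Collect_eq dirichlet_char_cong dirichlet_char_one)
    with 1 show ?thesis by simp
  next
    case 2
    then obtain \<psi> where \<psi>: "dirichlet_char m \<psi>" "\<psi> a \<noteq> 1"
      using exists_char_neq_1[OF m] by blast
    have inj: "inj_on (\<lambda>\<chi> n. \<psi> n * \<chi> n) ?X"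
    proof (rule inj_onI, rule ext)
      fix \<chi>1 \<chi>2 n assume *: "\<chi>1 \<in> ?X" "\<chi>2 \<in> ?X" "(\<lambda>n. \<psi> n * \<chi>1 n) = (\<lambda>n. \<psi> n * \<chi>2 n)"
      then have "\<psi> n * \<chi>1 n = \<psi> n * \<chi>2 n" by meson
      then show "\<chi>1 n = \<chi>2 n"
        using * dirichlet_charD(3)[of m _ n] \<psi>(1) by (metis mem_Collect_eq mult_cancel_left)
    qed
    have "(\<lambda>\<chi> n. \<psi> n * \<chi> n) ` ?X = ?X"
      using inj finite_dirichlet_chars[OF m0] dirichlet_char_mult[OF \<psi>(1)]
      by (intro endo_inj_surj) auto
    then have "(\<Sum>\<chi>\<in>?X. \<chi> a) = (\<Sum>\<chi>\<in>?X. \<psi> a * \<chi> a)"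
      using sum.reindex[OF inj, of "\<lambda>\<chi>. \<chi> a"] by simp
    also have "\<dots> = \<psi> a * (\<Sum>\<chi>\<in>?X. \<chi> a)" by (simp add: sum_distrib_left)
    finally have "(\<Sum>\<chi>\<in>?X. \<chi> a) = \<psi> a * (\<Sum>\<chi>\<in>?X. \<chi> a)" .
    then show ?thesis using \<psi>(2) 2 by simp
  next
    case 3
    then have "\<not> [a = 1] (mod m)"
      by (metis cong_imp_coprime cong_sym coprime_1_left)
    moreover have "(\<Sum>\<chi>\<in>?X. \<chi> a) = 0"
      using 3 by (intro sum.neutral) (auto simp: dirichlet_charD(3))
    ultimately show ?thesis by simp
  qed
qed

section \<open>Primes in arithmetic progressions\<close>

text \<open>The bound is 0 at \<open>N = 1\<close>, and its increments dominate the summands: this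
  reduces to \<open>(x + 1) * (ln (x + 1) - ln x) \<le> 1 + 1 / x \<le> 2\<close>.\<close>

lemma sum_ln_div_telescope:
  assumes "N \<ge> 1"
  shows "(\<Sum>n=2..N. ln (real n) / (real n * (real n - 1))) \<le> 2 - (2 + ln (real N)) / real N"
  using assms
proof (induction N rule: dec_induct)
  case (step N)
  define x where "x = real N"
  have x: "x \<ge> 1" using step by (simp add: x_def)
  have "ln (1 + 1 / x) \<le> 1 / x" using x by (intro ln_add_one_self_le_self) auto
  moreover have "ln (1 + 1 / x) = ln (x + 1) - ln x"
    using x ln_div[of "x + 1" x] by (simp add: add_divide_distrib add.commute)
  ultimately have "(x + 1) * ln x \<ge> (x + 1) * (ln (x + 1) - 1 / x)"
    using x by (intro mult_left_mono) auto
  also have "(x + 1) * (ln (x + 1) - 1 / x) = (x + 1) * ln (x + 1) - 1 - 1 / x"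
    using x by (simp add: field_simps)
  finally have "(x + 1) * ln x \<ge> (x + 1) * ln (x + 1) - 2"
    using x by (smt (verit) divide_le_eq_1)
  then have "ln (x + 1) \<le> (2 + ln x) * (x + 1) - (2 + ln (x + 1)) * x"
    by (simp add: algebra_simps)
  then have "ln (x + 1) / ((x + 1) * x) \<le> ((2 + ln x) * (x + 1) - (2 + ln (x + 1)) * x) / ((x + 1) * x)"
    using x by (intro divide_right_mono) auto
  also have "\<dots> = (2 + ln x) / x - (2 + ln (x + 1)) / (x + 1)"
    using x by (simp add: divide_simps)
  finally show ?case using step by (simp add: x_def add.commute)
qed auto

text \<open>Only prime powers with exponent at least 2 contribute. Enlarging to all bases from 2 on,
  the geometric series in \<open>k\<close> leaves the telescoping sum.\<close>

lemma sum_mangoldt_nonprime_le: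
  "(\<Sum>n | n \<in> {1..N} \<and> \<not> prime n. mangoldt n / real n) \<le> 2"
proof (cases "N = 0")
  case False
  have "(\<Sum>n | n \<in> {1..N} \<and> \<not> prime n. mangoldt n / real n) =
      (\<Sum>n | n \<in> {1..N} \<and> \<not> prime n \<and> primepow n. mangoldt n / real n)"
    by (rule sum.mono_neutral_right) (auto simp: mangoldt_def)
  also have "\<dots> \<le> (\<Sum>(p, k)\<in>{2..N} \<times> {2..N}. ln (real p) * (1 / real p) ^ k)"
  proof (rule sum_le_included[where i = "\<lambda>(p, k). p ^ k"])
    show "\<forall>n\<in>{n \<in> {1..N}. \<not> prime n \<and> primepow n}. \<exists>y\<in>{2..N} \<times> {2..N}.
        (case y of (p, k) \<Rightarrow> p ^ k) = n \<and>
        mangoldt n / real n \<le> (case y of (p, k) \<Rightarrow> ln (real p) * (1 / real p) ^ k)"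
    proof
      fix n assume n: "n \<in> {n \<in> {1..N}. \<not> prime n \<and> primepow n}"
      then obtain p k where pk: "prime p" "k > 0" "n = p ^ k" by (auto simp: primepow_def)
      have "k \<noteq> 1" using n pk by auto
      moreover have "p \<ge> 2" using pk prime_ge_2_nat by blast
      moreover have "p \<le> p ^ k" using pk \<open>p \<ge> 2\<close> by (intro self_le_power) auto
      moreover have "k < p ^ k" using \<open>p \<ge> 2\<close> by (intro power_gt_expt) auto
      ultimately have "(p, k) \<in> {2..N} \<times> {2..N}" using n pk by auto
      moreover have "mangoldt n / real n = ln (real p) * (1 / real p) ^ k"
        using pk by (simp add: power_divide)
      ultimately show "\<exists>y\<in>{2..N} \<times> {2..N}. (case y of (p, k) \<Rightarrow> p ^ k) = n \<and>
          mangoldt n / real n \<le> (case y of (p, k) \<Rightarrow> ln (real p) * (1 / real p) ^ k)"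
        using pk(3) by (intro bexI[of _ "(p, k)"]) auto
    qed
  qed auto
  also have "\<dots> = (\<Sum>p=2..N. ln (real p) * (\<Sum>k=2..N. (1 / real p) ^ k))"
    by (simp add: sum.cartesian_product sum_distrib_left)
  also have "\<dots> \<le> (\<Sum>p=2..N. ln (real p) / (real p * (real p - 1)))"
  proof (rule sum_mono)
    fix p assume p: "p \<in> {2..N}"
    define x where "x = 1 / real p"
    have x: "0 < x" "x < 1" using p by (auto simp: x_def)
    have "(\<Sum>k=2..N. x ^ k) = (x ^ 2 - x ^ Suc N) / (1 - x)"
      using p x by (simp add: sum_gp)
    also have "\<dots> \<le> x ^ 2 / (1 - x)" using x by (intro divide_right_mono) auto
    also have "\<dots> = 1 / (real p * (real p - 1))"
      using p by (simp add: x_def field_simps power2_eq_square)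
    finally have "ln (real p) * (\<Sum>k=2..N. x ^ k) \<le> ln (real p) * (1 / (real p * (real p - 1)))"
      using p by (intro mult_left_mono) auto
    then show "ln (real p) * (\<Sum>k=2..N. (1 / real p) ^ k) \<le> ln (real p) / (real p * (real p - 1))"
      by (simp add: x_def)
  qed
  also have "\<dots> \<le> 2 - (2 + ln (real N)) / real N"
    using False by (intro sum_ln_div_telescope) auto
  also have "\<dots> \<le> 2" using False by simp
  finally show ?thesis .
qed auto

section \<open>Logarithmic derivatives of L-functions and Dirichlet's theorem\<close>

text \<open>Partial sums of the Dirichlet series of \<open>- L' / L\<close> at 1.\<close>

definition mangoldt_char_sum :: "(nat \<Rightarrow> complex) \<Rightarrow> nat \<Rightarrow> complex" where
  "mangoldt_char_sum \<chi> N = (\<Sum>n=1..N. \<chi> n * mangoldt n / of_nat n)"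

lemma mangoldt_char_sum_principal:
  "mangoldt_char_sum (principal_char m) N =
    of_real (\<Sum>n | n \<in> {1..N} \<and> coprime n m. mangoldt n / real n)"
proof -
  have "mangoldt_char_sum (principal_char m) N =
      (\<Sum>n | n \<in> {1..N} \<and> coprime n m. mangoldt n / of_nat n)"
    unfolding mangoldt_char_sum_def principal_char_def
    by (intro sum.mono_neutral_cong_right) auto
  then show ?thesis by simp
qed

lemma sum_chars_mangoldt_char_sum:
  assumes "squarefree m"
  shows "(\<Sum>\<chi> | dirichlet_char m \<chi>. \<chi> b * mangoldt_char_sum \<chi> N) =
    of_real (real (card {\<chi>. dirichlet_char m \<chi>}) *
      (\<Sum>n | n \<in> {1..N} \<and> [b * n = 1] (mod m). mangoldt n / real n))"
proof -
  let ?X = "{\<chi>. dirichlet_char m \<chi>}"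
  have "(\<Sum>\<chi>\<in>?X. \<chi> b * mangoldt_char_sum \<chi> N) = (\<Sum>\<chi>\<in>?X. \<Sum>n=1..N. \<chi> (b * n) * (mangoldt n / of_nat n))"
    unfolding mangoldt_char_sum_def sum_distrib_left
    by (intro sum.cong refl) (auto simp: dirichlet_charD(1))
  also have "\<dots> = (\<Sum>n=1..N. (\<Sum>\<chi>\<in>?X. \<chi> (b * n)) * (mangoldt n / of_nat n))"
    by (subst sum.swap) (simp only: sum_distrib_right)
  also have "\<dots> = (\<Sum>n | n \<in> {1..N} \<and> [b * n = 1] (mod m). of_nat (card ?X) * (mangoldt n / of_nat n))"
    unfolding sum_chars[OF assms] by (intro sum.mono_neutral_cong_right) auto
  finally show ?thesis by (simp add: sum_distrib_left)
qed

lemma sum_union_le: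
  fixes f :: "'a \<Rightarrow> real"
  assumes "finite A" "finite B" "\<And>x. f x \<ge> 0"
  shows "sum f (A \<union> B) \<le> sum f A + sum f B"
  using sum.union_inter[OF assms(1,2), of f] sum_nonneg[of "A \<inter> B" f] assms(3) by simp

lemma ln_nat_unbounded: "\<exists>N>0. ln (real N) > (K::real)"
proof -
  obtain N where N: "real N > exp K" using reals_Archimedean2 by blast
  then have "real N > 0" by (meson exp_gt_zero less_trans)
  then show ?thesis using N by (intro exI[of _ N]) (metis exp_less_cancel_iff exp_ln of_nat_0_less_iff)
qed

text \<open>Two vanishing characters would contribute \<open>- 2 * ln N\<close>, against at most
  \<open>3 / 2 * ln N\<close> from the principal one; the total would become negative.\<close>

lemma no_two_vanishing_chars:
  assumes m: "squarefree m"
    and chars: "dirichlet_char m \<chi>" "dirichlet_char m \<psi>"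
    and np: "\<chi> \<noteq> principal_char m" "\<psi> \<noteq> principal_char m"
    and zero: "cancelling_character.L1 \<chi> = 0" "cancelling_character.L1 \<psi> = 0"
  shows "\<chi> = \<psi>"
proof (rule ccontr)
  assume neq: "\<chi> \<noteq> \<psi>"
  have m0: "m > 0" using m by (auto intro: Nat.gr0I)
  let ?X = "{\<chi>. dirichlet_char m \<chi>}" and ?P = "principal_char m" and ?B = "2 * real m"
  note fin = finite_dirichlet_chars[OF m0]
  have vanish: "Re (mangoldt_char_sum \<phi> N) \<le> ?B - ln (real N)"
    if "dirichlet_char m \<phi>" "\<phi> \<noteq> ?P" "cancelling_character.L1 \<phi> = 0" "N > 0" for \<phi> N
  proof -
    have "norm (of_real (ln N) + mangoldt_char_sum \<phi> N) \<le> ?B"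
      using cancelling_character.mangoldt_sum_asymptotics[OF
          cancelling_character_nonprincipal[OF that(1) m0 that(2)] that(3,4)]
      by (simp add: mangoldt_char_sum_def)
    then show ?thesis
      using abs_Re_le_cmod[of "of_real (ln N) + mangoldt_char_sum \<phi> N"] by simp
  qed
  \<comment> \<open>An upper bound on the real part is enough, so further vanishing characters do no
    harm.\<close>
  have "\<exists>C. \<forall>N>0. Re (mangoldt_char_sum \<phi> N) \<le> C" if \<phi>: "dirichlet_char m \<phi>" "\<phi> \<noteq> ?P" for \<phi>
  proof (cases "cancelling_character.L1 \<phi> = 0")
    case True
    have "Re (mangoldt_char_sum \<phi> N) \<le> ?B" if N: "N > 0" for N
      using vanish[OF \<phi> True N] ln_ge_zero[of "real N"] N by linarith
    then show ?thesis by blast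
  next
    case False
    then obtain C where "\<forall>N. norm (mangoldt_char_sum \<phi> N) \<le> C"
      using cancelling_character.mangoldt_sum_bounded[OF
          cancelling_character_nonprincipal[OF \<phi>(1) m0 \<phi>(2)]]
      by (auto simp: mangoldt_char_sum_def)
    then show ?thesis by (meson complex_Re_le_cmod order_trans)
  qed
  then obtain C where C: "\<And>\<phi> N. dirichlet_char m \<phi> \<Longrightarrow> \<phi> \<noteq> ?P \<Longrightarrow> N > 0 \<Longrightarrow>
      Re (mangoldt_char_sum \<phi> N) \<le> C \<phi>"
    by metis
  define Y where "Y = ?X - {?P, \<chi>, \<psi>}"
  have Y: "finite Y" "?P \<notin> Y" "\<chi> \<notin> Y" "\<psi> \<notin> Y" using fin by (auto simp: Y_def)
  have ins: "?X = insert ?P (insert \<chi> (insert \<psi> Y))"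
    using chars dirichlet_char_principal by (auto simp: Y_def)
  define K where "K = (\<Sum>\<phi>\<in>Y. C \<phi>)"
  have bound: "1 / 2 * ln (real N) \<le> 3 / 2 * ln 2 + 2 * ?B + K" if N: "N > 0" for N
  proof -
    have "0 \<le> Re (\<Sum>\<phi>\<in>?X. \<phi> 1 * mangoldt_char_sum \<phi> N)"
      unfolding sum_chars_mangoldt_char_sum[OF m]
      by (auto intro!: mult_nonneg_nonneg sum_nonneg divide_nonneg_nonneg mangoldt_nonneg)
    also have "\<dots> = (\<Sum>\<phi>\<in>?X. Re (mangoldt_char_sum \<phi> N))"
      unfolding Re_sum by (intro sum.cong) (auto simp: dirichlet_char_one)
    also have "\<dots> = Re (mangoldt_char_sum ?P N) + (Re (mangoldt_char_sum \<chi> N) +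
        (Re (mangoldt_char_sum \<psi> N) + (\<Sum>\<phi>\<in>Y. Re (mangoldt_char_sum \<phi> N))))"
      using Y np neq by (subst ins) simp
    also have "\<dots> \<le> 3 / 2 * ln (2 * real N) + ((?B - ln (real N)) + ((?B - ln (real N)) + K))"
    proof (intro add_mono)
      have "Re (mangoldt_char_sum ?P N) = (\<Sum>n | n \<in> {1..N} \<and> coprime n m. mangoldt n / real n)"
        by (simp add: mangoldt_char_sum_principal)
      also have "\<dots> \<le> (\<Sum>n=1..N. mangoldt n / real n)"
        by (intro sum_mono2) (auto intro!: divide_nonneg_nonneg mangoldt_nonneg)
      also have "\<dots> \<le> 3 / 2 * ln (2 * real N)" using N by (rule sum_mangoldt_div_le)
      finally show "Re (mangoldt_char_sum ?P N) \<le> 3 / 2 * ln (2 * real N)" .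
      show "(\<Sum>\<phi>\<in>Y. Re (mangoldt_char_sum \<phi> N)) \<le> K"
        unfolding K_def using N by (intro sum_mono C) (auto simp: Y_def)
    qed (use vanish chars np zero N in auto)
    also have "\<dots> = 3 / 2 * ln 2 + 2 * ?B + K - 1 / 2 * ln (real N)"
      using N by (simp add: ln_mult algebra_simps)
    finally show ?thesis by simp
  qed
  obtain N where "N > 0" "ln (real N) > 2 * (3 / 2 * ln 2 + 2 * ?B + K)"
    using ln_nat_unbounded by blast
  with bound[of N] show False by simp
qed

text \<open>The conjugate of a vanishing character vanishes too, hence coincides with it. The
  character is then real with values -1, 0, 1, and Monsky's argument applies.\<close>

lemma L1_nonzero:
  assumes m: "squarefree m" and \<chi>: "dirichlet_char m \<chi>" and np: "\<chi> \<noteq> principal_char m"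
  shows "cancelling_character.L1 \<chi> \<noteq> 0"
proof
  assume zero: "cancelling_character.L1 \<chi> = 0"
  have m0: "m > 0" using m by (auto intro: Nat.gr0I)
  interpret cancelling_character \<chi> "2 * real m"
    using cancelling_character_nonprincipal[OF \<chi> m0 np] .
  have lim: "(\<lambda>N. \<Sum>n=1..N. \<chi> n / of_nat n) \<longlonglongrightarrow> 0"
    using L1_limit zero by simp
  let ?\<psi> = "\<lambda>n. cnj (\<chi> n)"
  note \<psi> = dirichlet_char_cnj[OF \<chi>]
  have \<psi>np: "?\<psi> \<noteq> principal_char m"
  proof
    assume *: "?\<psi> = principal_char m"
    have "\<chi> n = principal_char m n" for n
      using fun_cong[OF *, of n] by (auto simp: principal_char_def split: if_splits)
    with np show False by blast
  qed
  have "(\<lambda>N. cnj (\<Sum>n=1..N. \<chi> n / of_nat n)) \<longlonglongrightarrow> cnj 0"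
    by (intro tendsto_cnj lim)
  then have "(\<lambda>N. \<Sum>n=1..N. ?\<psi> n / of_nat n) \<longlonglongrightarrow> 0" by simp
  then have "cancelling_character.L1 ?\<psi> = 0"
    using cancelling_character.L1_limit[OF cancelling_character_nonprincipal[OF \<psi> m0 \<psi>np]]
      LIMSEQ_unique by blast
  then have eq: "\<chi> = ?\<psi>"
    using no_two_vanishing_chars[OF m \<chi> \<psi> np \<psi>np] zero by blast
  have im: "Im (\<chi> n) = 0" for n
    using arg_cong[OF fun_cong[OF eq, of n], of Im] by simp
  define f where "f = (\<lambda>n. Re (\<chi> n))"
  have "f n \<in> {-1, 0, 1}" for n
    using norm_dirichlet_char[OF \<chi> m0, of n] im[of n]
    by (auto simp: f_def cmod_eq_Re split: if_splits)
  moreover have "f (a * b) = f a * f b" for a b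
    using im by (simp add: f_def mult)
  moreover have "\<bar>\<Sum>n=M..<N. f n\<bar> \<le> 2 * real m" for M N
    using order_trans[OF abs_Re_le_cmod norm_sum_le[of M N]] by (simp add: f_def)
  moreover have "(\<lambda>N. Re (\<Sum>n=1..N. \<chi> n / of_nat n)) \<longlonglongrightarrow> Re 0"
    by (intro tendsto_Re lim)
  then have "(\<lambda>N. \<Sum>n=1..N. f n / real n) \<longlonglongrightarrow> 0" by (simp add: f_def)
  ultimately show False
    by (intro sign_character_sum_nonzero[of f "2 * real m"]) (auto simp: f_def)
qed

text \<open>Finitely many primes would keep the \<open>mangoldt\<close> sum over the progression
  bounded. By orthogonality, that sum differs by bounded terms from a multiple of the principal sum,
  which grows like \<open>ln N\<close>.\<close>

theorem dirichlet_primes_squarefree_modulus: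
  fixes m a :: nat
  assumes m: "squarefree m" and a: "coprime a m"
  shows "infinite {p. prime p \<and> [p = a] (mod m)}"
proof
  assume fin: "finite {p. prime p \<and> [p = a] (mod m)}"
  have m0: "m > 0" using m by (auto intro: Nat.gr0I)
  \<comment> \<open>The inverse \<open>b\<close> of \<open>a\<close> replaces conjugation:
    \<open>\<chi> b\<close> is the conjugate of \<open>\<chi> a\<close>.\<close>
  obtain b where b: "[a * b = 1] (mod m)" using cong_solve_coprime_nat[OF a] by auto
  let ?X = "{\<chi>. dirichlet_char m \<chi>}" and ?P = "principal_char m"
  note finX = finite_dirichlet_chars[OF m0]
  have iff: "[b * n = 1] (mod m) \<longleftrightarrow> [n = a] (mod m)" for n
  proof
    assume "[b * n = 1] (mod m)"
    then have "[a * (b * n) = a * 1] (mod m)" by (rule cong_scalar_left)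
    moreover have "[a * b * n = 1 * n] (mod m)" using b by (rule cong_scalar_right)
    ultimately show "[n = a] (mod m)"
      by (metis cong_sym cong_trans mult.assoc mult_1 mult_1_right)
  next
    assume "[n = a] (mod m)"
    then have "[b * n = b * a] (mod m)" by (rule cong_scalar_left)
    with b show "[b * n = 1] (mod m)" by (metis cong_trans mult.commute)
  qed
  have "coprime b m"
    using b by (metis cong_imp_coprime cong_sym coprime_1_left coprime_mult_left_iff)
  then have Pb: "?P b = 1" by (simp add: principal_char_def)
  have nb: "norm (\<chi> b) \<le> 1" if "dirichlet_char m \<chi>" for \<chi>
    using norm_dirichlet_char[OF that m0, of b] by simp
  have "\<exists>C. \<forall>N. norm (mangoldt_char_sum \<chi> N) \<le> C" if "dirichlet_char m \<chi>" "\<chi> \<noteq> ?P" for \<chi>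
    using cancelling_character.mangoldt_sum_bounded[OF
        cancelling_character_nonprincipal[OF that(1) m0 that(2)] L1_nonzero[OF m that]]
    by (auto simp: mangoldt_char_sum_def)
  then obtain C where C: "\<And>\<chi> N. dirichlet_char m \<chi> \<Longrightarrow> \<chi> \<noteq> ?P \<Longrightarrow> norm (mangoldt_char_sum \<chi> N) \<le> C \<chi>"
    by metis
  define K1 where "K1 = (\<Sum>\<chi>\<in>?X - {?P}. C \<chi>)"
  define K2 where "K2 = (\<Sum>p | prime p \<and> [p = a] (mod m). mangoldt p / real p)"
  define K3 where "K3 = (\<Sum>p\<in>prime_factors m. mangoldt p / real p)"
  have nonneg: "mangoldt n / real n \<ge> 0" for n
    by (intro divide_nonneg_nonneg mangoldt_nonneg) auto
  \<comment> \<open>The 3 is 1 from \<open>sum_mangoldt_div_ge\<close> plus 2 from the nonprime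
    terms; \<open>K1\<close>, \<open>K2\<close>, \<open>K3\<close> account for nonprincipal
    characters, primes in the progression and primes dividing \<open>m\<close>.\<close>
  have bound: "ln (real N) \<le> 3 + K3 + K1 + real (card ?X) * (K2 + 2)" if N: "N > 0" for N
  proof -
    let ?Q = "\<Sum>n | n \<in> {1..N} \<and> coprime n m. mangoldt n / real n"
    let ?R = "\<Sum>n | n \<in> {1..N} \<and> [b * n = 1] (mod m). mangoldt n / real n"
    let ?T = "\<Sum>n | n \<in> {1..N} \<and> \<not> prime n. mangoldt n / real n"
    have "{1..N} \<subseteq> {n. n \<in> {1..N} \<and> coprime n m} \<union> ({n. n \<in> {1..N} \<and> \<not> prime n} \<union> prime_factors m)"
      using m0 by (auto simp: in_prime_factors_iff prime_imp_coprime)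
    then have "(\<Sum>n=1..N. mangoldt n / real n) \<le> (\<Sum>n\<in>{n. n \<in> {1..N} \<and> coprime n m} \<union>
        ({n. n \<in> {1..N} \<and> \<not> prime n} \<union> prime_factors m). mangoldt n / real n)"
      by (intro sum_mono2 nonneg) auto
    also have "\<dots> \<le> ?Q + (?T + K3)"
      unfolding K3_def
      by (intro order_trans[OF sum_union_le] add_left_mono) (auto intro!: nonneg sum_nonneg)
    finally have Q: "ln (real N) - 1 \<le> ?Q + (2 + K3)"
      using sum_mangoldt_div_ge[OF N] sum_mangoldt_nonprime_le[of N] by linarith
    have "{n. n \<in> {1..N} \<and> [b * n = 1] (mod m)} \<subseteq>
        {p. prime p \<and> [p = a] (mod m)} \<union> {n. n \<in> {1..N} \<and> \<not> prime n}"
      using iff by blast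
    then have "?R \<le> (\<Sum>n\<in>{p. prime p \<and> [p = a] (mod m)} \<union> {n. n \<in> {1..N} \<and> \<not> prime n}. mangoldt n / real n)"
      using fin by (intro sum_mono2 nonneg) auto
    also have "\<dots> \<le> K2 + ?T"
      unfolding K2_def using fin by (intro sum_union_le) (auto intro!: nonneg)
    finally have "?R \<le> K2 + 2" using sum_mangoldt_nonprime_le[of N] by linarith
    then have R: "real (card ?X) * ?R \<le> real (card ?X) * (K2 + 2)" by (intro mult_left_mono) auto
    have "of_real (real (card ?X) * ?R) = (\<Sum>\<chi>\<in>?X. \<chi> b * mangoldt_char_sum \<chi> N)"
      using sum_chars_mangoldt_char_sum[OF m] by simp
    also have "\<dots> = of_real ?Q + (\<Sum>\<chi>\<in>?X - {?P}. \<chi> b * mangoldt_char_sum \<chi> N)"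
      using finX dirichlet_char_principal
      by (subst sum.remove[of _ ?P]) (auto simp: Pb mangoldt_char_sum_principal)
    finally have "of_real ?Q = of_real (real (card ?X) * ?R) - (\<Sum>\<chi>\<in>?X - {?P}. \<chi> b * mangoldt_char_sum \<chi> N)"
      by simp
    then have "Re (of_real ?Q) = Re (of_real (real (card ?X) * ?R) - (\<Sum>\<chi>\<in>?X - {?P}. \<chi> b * mangoldt_char_sum \<chi> N))"
      by (rule arg_cong)
    then have "?Q = real (card ?X) * ?R - Re (\<Sum>\<chi>\<in>?X - {?P}. \<chi> b * mangoldt_char_sum \<chi> N)"
      by (simp only: Re_complex_of_real minus_complex.sel)
    moreover have "norm (\<Sum>\<chi>\<in>?X - {?P}. \<chi> b * mangoldt_char_sum \<chi> N) \<le> K1"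
      unfolding K1_def
    proof (rule sum_norm_le)
      fix \<chi> assume "\<chi> \<in> ?X - {?P}"
      then have "norm (\<chi> b) * norm (mangoldt_char_sum \<chi> N) \<le> 1 * C \<chi>"
        by (intro mult_mono nb C) auto
      then show "norm (\<chi> b * mangoldt_char_sum \<chi> N) \<le> C \<chi>" by (simp add: norm_mult)
    qed
    then have "- Re (\<Sum>\<chi>\<in>?X - {?P}. \<chi> b * mangoldt_char_sum \<chi> N) \<le> K1"
      using abs_Re_le_cmod[of "\<Sum>\<chi>\<in>?X - {?P}. \<chi> b * mangoldt_char_sum \<chi> N"] by linarith
    ultimately show ?thesis using Q R by linarith
  qed
  obtain N where "N > 0" "ln (real N) > 3 + K3 + K1 + real (card ?X) * (K2 + 2)"
    using ln_nat_unbounded by blast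
  with bound[of N] show False by simp
qed

section \<open>A prime with prescribed residues modulo small odd primes\<close>

theorem theorem2p2:
  fixes p1 p2 :: nat
  assumes "prime p1" and "odd p1"
    and "prime p2" and "odd p2"
    and "p1 \<noteq> p2"
  shows "\<exists>p0::nat. prime p0 \<and> odd p0 \<and>
           p2 dvd p0 + p1 \<and>
           (\<forall>q::nat. prime q \<and> odd q \<and> q dvd p0 + p1 \<longrightarrow> p2 \<le> q)"
proof -
  define A where "A = {q. prime q \<and> odd q \<and> q \<le> p2}"
  define m where "m = \<Prod>A"
  have finA: "finite A" unfolding A_def by simp
  have cop: "coprime q r" if "q \<in> A" "r \<in> A" "q \<noteq> r" for q r
    using that by (auto simp: A_def intro: primes_coprime)
  have sqf: "squarefree m"
    unfolding m_def using cop by (intro squarefree_prod_coprime) (auto simp: A_def intro: squarefree_prime)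
  \<comment> \<open>Modulo \<open>q\<close>, these residues make \<open>p0 + p1\<close> congruent to
    \<open>p2 * p1\<close> at \<open>q = p2\<close>, to 1 at \<open>q = p1\<close>, and to
    \<open>2 * p1\<close> otherwise; only the first is divisible by its \<open>q\<close>. The factor
    \<open>p2 - 1\<close> represents -1 in \<open>nat\<close>.\<close>
  define r where "r = (\<lambda>q. if q = p2 then (p2 - 1) * p1 else if q = p1 then 1 else p1)"
  obtain a where a: "\<And>q. q \<in> A \<Longrightarrow> [a = r q] (mod q)"
    using chinese_remainder_nat[OF finA, of "\<lambda>q. q" r] cop by auto
  have r_coprime: "coprime (r q) q" if "q \<in> A" for q
  proof -
    have q: "prime q" using that by (simp add: A_def)
    have "coprime p1 q" if "q \<noteq> p1" using that q assms(1) by (simp add: primes_coprime)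
    moreover have "coprime (p2 - 1) p2"
      using prime_gt_0_nat[OF assms(3)] by (rule coprime_diff_one_left_nat)
    ultimately show ?thesis using assms(5) by (auto simp: r_def)
  qed
  have "coprime a m"
    unfolding m_def
  proof (rule prod_coprime_right)
    fix q assume "q \<in> A"
    then show "coprime a q" using a r_coprime by (metis cong_imp_coprime cong_sym)
  qed
  then have "infinite {p. prime p \<and> [p = a] (mod m)}"
    using dirichlet_primes_squarefree_modulus[OF sqf] by blast
  then obtain p0 where p0: "prime p0" "[p0 = a] (mod m)" "p0 > 2"
    unfolding infinite_nat_iff_unbounded by blast
  have cong: "[p0 + p1 = r q + p1] (mod q)" if "q \<in> A" for q
  proof -
    have "q dvd m" unfolding m_def using dvd_prodI[OF finA that, of "\<lambda>q. q"] by simp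
    then have "[p0 = a] (mod q)" using p0(2) cong_dvd_modulus_nat by blast
    with a[OF that] show ?thesis by (metis cong_add_rcancel_nat cong_trans)
  qed
  have p2A: "p2 \<in> A" using assms by (simp add: A_def)
  have "r p2 + p1 = p2 * p1"
    using prime_gt_0_nat[OF assms(3)] by (simp add: r_def algebra_simps)
  then have "p2 dvd p0 + p1"
    using cong[OF p2A] by (metis cong_dvd_iff dvd_triv_left)
  moreover have "p2 \<le> q" if q: "prime q" "odd q" "q dvd p0 + p1" for q
  proof (rule ccontr)
    assume "\<not> p2 \<le> q"
    then have "q \<in> A" "q \<noteq> p2" using q by (auto simp: A_def)
    then have dvd: "q dvd r q + p1" using cong q(3) cong_dvd_iff by blast
    show False
    proof (cases "q = p1")
      case True
      then have "q dvd 1 + q" using dvd \<open>q \<noteq> p2\<close> by (simp add: r_def)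
      then have "q dvd 1" by (simp only: dvd_add_left_iff[OF dvd_refl])
      with q(1) show False by simp
    next
      case False
      then have "q dvd 2 * p1" using dvd \<open>q \<noteq> p2\<close> by (simp add: r_def mult_2)
      then have "q dvd 2 \<or> q dvd p1" using q(1) prime_dvd_mult_iff by blast
      then show False
        using q False assms(1) primes_dvd_imp_eq two_is_prime_nat by (metis even_numeral)
    qed
  qed
  moreover have "odd p0" using p0 prime_odd_nat by blast
  ultimately show ?thesis using p0(1) by blast
qed

end
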